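(* Let $1<p<\infty$ and let $q$ be the conjugate exponent of $p$, so that $p^{-1}+q^{-1}=1$. Then the Riesz projection $\mathbf{P}$, initially defined on trigonometric polynomials, extends to a bounded linear operator on $L^p(\mathbb{T})$ satisfying \[\|\mathbf{P}f\|_p \leq \max(p,q)\, \|f\|_p\] for every $f \in L^p(\mathbb{T})$.
   Context: $\mathbb{T}$ is the unit circle endowed with the normalized Lebesgue arc length measure (total mass $1$), $L^p(\mathbb{T})$ is the corresponding Lebesgue space of complex-valued functions, and $\|\cdot\|_p$ is its norm. A trigonometric polynomial is a finite sum $f(e^{i\theta}) = \sum_{n\in\mathbb{Z}} \widehat{f}(n)\, e^{in\theta}$ with complex coefficients, only finitely many of which are nonzero. Trigonometric polynomials are dense in $L^p(\mathbb{T})$ for $1\leq p<\infty$. The Riesz projection $\mathbf{P}$ is defined on trigonometric polynomials by \[\mathbf{P}\left(\sum_{n \in \mathbb{Z}} \widehat{f}(n)\, e^{in\theta}\right) = \sum_{n=0}^\infty \widehat{f}(n) \,e^{in\theta}.\] *)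

theory Defs
  imports "HOL-Analysis.Analysis"
begin

text \<open>
  Normalized arc length measure on the unit circle: the push-forward of the uniform
  distribution on \<open>[0, 2\<pi>]\<close> under \<open>\<theta> \<mapsto> e\<^sup>i\<^sup>\<theta>\<close>. Its space is the unit circle itself, so
  values of a function \<open>complex \<Rightarrow> complex\<close> off the circle are irrelevant.
\<close>

definition circle :: "complex measure" where
  "circle = distr (uniform_measure lborel {0..2 * pi}) (restrict_space borel (sphere 0 1)) cis"

lemma space_circle: "space circle = sphere 0 1"
  by (simp add: circle_def space_restrict_space)

lemma measurable_cis_sphere: "cis \<in> borel \<rightarrow>\<^sub>M restrict_space borel (sphere 0 1)"
  by (intro measurable_restrict_space2 borel_measurable_continuous_onI)
     (auto intro!: continuous_intros)

lemma emeasure_space_circle: "emeasure circle (space circle) = 1"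
proof -
  have *: "cis \<in> uniform_measure lborel {0..2 * pi} \<rightarrow>\<^sub>M restrict_space borel (sphere 0 1)"
    using measurable_cis_sphere by (simp add: measurable_def)
  have "cis -` sphere 0 1 = UNIV"
    by auto
  moreover have "sphere (0 :: complex) 1 \<in> sets (restrict_space borel (sphere 0 1))"
    using sets.top[of "restrict_space borel (sphere (0 :: complex) 1)"]
    by (simp add: space_restrict_space)
  moreover have "ennreal (2 * pi) / ennreal (2 * pi) = 1"
    using pi_gt_zero by (intro ennreal_divide_self) (auto simp: ennreal_eq_0_iff not_le)
  ultimately show ?thesis
    unfolding space_circle by (simp add: circle_def emeasure_distr[OF *])
qed

text \<open>
  \<open>L\<^sup>p\<close> of the circle is represented by its functions; the identification of almost
  everywhere equal functions is imposed where operators are considered.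
\<close>

definition Lp :: "real \<Rightarrow> (complex \<Rightarrow> complex) set" where
  "Lp p = {f \<in> borel_measurable circle. integrable circle (\<lambda>z. cmod (f z) powr p)}"

definition Lp_norm :: "real \<Rightarrow> (complex \<Rightarrow> complex) \<Rightarrow> real" where
  "Lp_norm p f = (LINT z|circle. cmod (f z) powr p) powr (1 / p)"

text \<open>
  The second clause says that \<open>T\<close> descends to almost everywhere equality classes, so that
  the predicate describes bounded linear operators on the quotient.
\<close>

definition bounded_linear_Lp :: "real \<Rightarrow> ((complex \<Rightarrow> complex) \<Rightarrow> complex \<Rightarrow> complex) \<Rightarrow> bool" where
  "bounded_linear_Lp p T \<longleftrightarrow>
     (\<forall>f\<in>Lp p. T f \<in> Lp p) \<and>
     (\<forall>f\<in>Lp p. \<forall>g\<in>Lp p. (AE z in circle. f z = g z) \<longrightarrow> (AE z in circle. T f z = T g z)) \<and>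
     (\<forall>f\<in>Lp p. \<forall>g\<in>Lp p. AE z in circle. T (\<lambda>w. f w + g w) z = T f z + T g z) \<and>
     (\<forall>a. \<forall>f\<in>Lp p. AE z in circle. T (\<lambda>w. a * f w) z = a * T f z) \<and>
     (\<exists>C. \<forall>f\<in>Lp p. Lp_norm p (T f) \<le> C * Lp_norm p f)"

text \<open>
  A trigonometric polynomial is given by its finitely supported coefficient sequence
  \<open>c\<close>; at \<open>z = e\<^sup>i\<^sup>\<theta>\<close> one has \<open>z powi n = e\<^sup>i\<^sup>n\<^sup>\<theta>\<close>.
\<close>

definition trig_poly :: "(int \<Rightarrow> complex) \<Rightarrow> complex \<Rightarrow> complex" where
  "trig_poly c z = (\<Sum>n | c n \<noteq> 0. c n * z powi n)"

definition riesz_coeffs :: "(int \<Rightarrow> complex) \<Rightarrow> int \<Rightarrow> complex" where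
  "riesz_coeffs c n = (if 0 \<le> n then c n else 0)"

definition extends_riesz_projection :: "((complex \<Rightarrow> complex) \<Rightarrow> complex \<Rightarrow> complex) \<Rightarrow> bool" where
  "extends_riesz_projection T \<longleftrightarrow>
     (\<forall>c. finite {n. c n \<noteq> 0} \<longrightarrow>
        (AE z in circle. T (trig_poly c) z = trig_poly (riesz_coeffs c) z))"

end

theory Submission
  imports Defs
begin

text \<open>
  For \<open>1 < p \<le> 2\<close> write a trigonometric polynomial as \<open>f = u + cnj v\<close> with \<open>u = P f\<close> and \<open>u, v\<close>
  polynomials in \<open>z\<close>, \<open>v 0 = 0\<close>. Up to an \<open>\<epsilon>\<close>-regularisation, the function
  \<open>|u + cnj v|\<^sup>p / (p - 1) - (|u|\<^sup>2 + |v|\<^sup>2)\<^bsup>p/2\<^esup>\<close> is subharmonic on the disc and nonnegative at the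
  origin, so its mean over the circle is nonnegative and
  \<open>\<parallel>P f\<parallel>\<^sup>p \<le> \<parallel>f\<parallel>\<^sup>p / (p - 1) \<le> q\<^sup>p \<parallel>f\<parallel>\<^sup>p\<close>. For \<open>p > 2\<close> the bound follows by duality, since the
  projection is self-adjoint on trigonometric polynomials. Density of the trigonometric
  polynomials in \<open>L\<^sup>p\<close> and completeness give the extension.
\<close>

subsection \<open>The pointwise inequality\<close>

text \<open>The delicate choice is the subtracted term. For p < 2 the Laplacian of |u|^p is p^2
  |u|^(p-2) |u'|^2, which blows up at a simple zero of u; if v does not vanish there, |u + cnj v|^p
  is smooth and cannot compensate. Adding |v|^2 removes this obstacle: with Q = |u + cnj v|^2 and N
  = |u|^2 + |v|^2 one has Q \<le> 2 N, so N^(p/2-1) \<le> 2^(1-p/2) Q^(p/2-1), and N vanishes only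
  where Q does. As u and v are holomorphic and u + cnj v is harmonic, second derivatives drop out of
  both Laplacians, and subharmonicity becomes an algebraic inequality between the numbers u, v, u',
  v'. The constant comes from it: with a = 1 - p/2, Cauchy-Schwarz shows that the Laplacian of
  Q^(p/2) keeps at least the fraction 1 - 2a = p - 1 of its leading term. The inequality is set up
  for 0 \<le> a \<le> 1/2, hence the separate treatment of p > 2. The regularisation keeps the
  powers twice differentiable at zeros. At the origin v vanishes, so both powers agree there and 1 /
  (p - 1) \<ge> 1 gives the sign.\<close>

lemma bernoulli_powr_le:
  fixes a x :: real
  assumes "0 \<le> a" "a \<le> 1" "0 < x"
  shows "x powr a \<le> 1 + a * (x - 1)"
  using Youngs_inequality_0[of a "1 - a" x 1] assms by (simp add: algebra_simps)

text \<open>The real-variable core of \<open>levi_form_ineq\<close>: there \<rho> is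
  \<open>Q / N\<close>, and A, B are the squared first-order terms divided by N and Q. A \<le> t and
  B \<le> 2 * t come from Cauchy-Schwarz, the second bound on B from the parallelogram law. For
  \<rho> \<le> 1 the bound B \<le> 2 * t is enough. For \<rho> > 1 the gain in
  \<open>\<rho> powr a\<close> is offset by a large A or, if A is small, by the second bound on
  B.\<close>

lemma levi_kernel_ineq:
  fixes a \<rho> A B t :: real
  assumes a: "0 \<le> a" "a \<le> 1/2" and \<rho>: "0 < \<rho>" "\<rho> \<le> 2"
    and t: "0 \<le> t" and A: "0 \<le> A" "A \<le> t" and B: "B \<le> 2 * t" "\<rho> * B \<le> 2 * (A + t)"
  shows "(1 - 2 * a) * \<rho> powr a * (t - a * A) \<le> t - a * B"
proof -
  have "a * A \<le> 1 * t"
    using a A t by (intro mult_mono) auto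
  then have tA: "0 \<le> t - a * A" by simp
  have aB: "a * B \<le> a * (2 * t)"
    using a B by (intro mult_left_mono) auto
  show ?thesis
  proof (cases "\<rho> \<le> 1")
    case True
    then have "\<rho> powr a \<le> 1"
      using \<rho> a by (simp add: powr_le1)
    then have "(1 - 2 * a) * \<rho> powr a * (t - a * A) \<le> (1 - 2 * a) * 1 * (t - a * A)"
      using a tA by (intro mult_right_mono mult_left_mono) auto
    also have "\<dots> \<le> (1 - 2 * a) * t"
      using a A by (auto intro!: mult_left_mono)
    also have "\<dots> \<le> t - a * B"
      using aB by (simp add: algebra_simps)
    finally show ?thesis .
  next
    case False
    define x where "x = \<rho> - 1"
    have x: "0 \<le> x" "x \<le> 1" and \<rho>x: "\<rho> = 1 + x"
      using False \<rho> by (auto simp: x_def)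
    have "\<rho> powr a \<le> 1 + a * x"
      using bernoulli_powr_le[of a \<rho>] a \<rho> by (simp add: \<rho>x)
    then have *: "(1 - 2 * a) * \<rho> powr a * (t - a * A) \<le> (1 - 2 * a) * (1 + a * x) * (t - a * A)"
      using a tA by (intro mult_right_mono mult_left_mono) auto
    show ?thesis
    \<comment> \<open>The two upper bounds 2 * t and 2 * (A + t) / \<rho> for B coincide exactly at
      A = x * t; each case uses the sharper one.\<close>
    proof (cases "x * t \<le> A")
      case True
      have "(1 + a * x) * (t - a * A) \<le> (1 + a * x) * (t - a * (x * t))"
        using True a x by (intro mult_left_mono diff_left_mono) auto
      also have "\<dots> = t - (a * x)\<^sup>2 * t"
        by (simp add: algebra_simps power2_eq_square)
      also have "\<dots> \<le> t" using t by simp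
      finally have "(1 - 2 * a) * ((1 + a * x) * (t - a * A)) \<le> (1 - 2 * a) * t"
        using a by (intro mult_left_mono) auto
      with * aB show ?thesis by (simp add: algebra_simps)
    next
      case False
      have "a * (\<rho> * B) \<le> a * (2 * (A + t))"
        using a B by (intro mult_left_mono) auto
      moreover have "\<rho> * ((1 - 2 * a) * (1 + a * x) * (t - a * A)) \<le> \<rho> * t - a * (2 * (A + t))"
      proof -
        text \<open>Both sides are affine in \<open>A\<close>, so the difference is the convex combination of
          its values at \<open>A = 0\<close> and \<open>A = x t\<close>.\<close>
        have e0: "(1 - 2 * a) * (1 + a * x) * (1 + x) \<le> (1 + x) - 2 * a"
        proof -
          have "(1 + x) - 2 * a - (1 - 2 * a) * (1 + a * x) * (1 + x)
              = a * x * (2 - (1 - 2 * a) * (1 + x))" by (simp add: algebra_simps)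
          moreover have "(1 - 2 * a) * (1 + x) \<le> 1 * 2"
            using a x by (intro mult_mono) auto
          ultimately show ?thesis using a x
            by (smt (verit, best) mult_nonneg_nonneg)
        qed
        have e1: "(1 - 2 * a) * (1 + a * x) * (1 - a * x) \<le> 1 - 2 * a"
        proof -
          have "(1 + a * x) * (1 - a * x) = 1 - (a * x)\<^sup>2"
            by (simp add: algebra_simps power2_eq_square)
          then have "(1 + a * x) * (1 - a * x) \<le> 1" by simp
          then have "(1 - 2 * a) * ((1 + a * x) * (1 - a * x)) \<le> (1 - 2 * a) * 1"
            using a by (intro mult_left_mono) auto
          then show ?thesis by (simp add: mult.assoc)
        qed
        have xt: "0 < x * t" using False A by linarith
        define l where "l = A / (x * t)"
        have l: "0 \<le> l" "l \<le> 1" and Al: "A = l * x * t"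
          using xt False A by (auto simp: l_def)
        have "\<rho> * t - a * (2 * (A + t)) - \<rho> * ((1 - 2 * a) * (1 + a * x) * (t - a * A))
           = t * ((1 - l) * (((1 + x) - 2 * a) - (1 - 2 * a) * (1 + a * x) * (1 + x))
               + l * (1 + x) * ((1 - 2 * a) - (1 - 2 * a) * (1 + a * x) * (1 - a * x)))"
          unfolding Al \<rho>x by algebra
        also have "\<dots> \<ge> 0"
          using t l x e0 e1 by (intro mult_nonneg_nonneg add_nonneg_nonneg) auto
        finally show ?thesis by simp
      qed
      ultimately have "\<rho> * ((1 - 2 * a) * (1 + a * x) * (t - a * A)) \<le> \<rho> * (t - a * B)"
        by (simp add: algebra_simps)
      then have "(1 - 2 * a) * (1 + a * x) * (t - a * A) \<le> t - a * B"
        using \<rho> by simp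
      with * show ?thesis by linarith
    qed
  qed
qed

text \<open>For holomorphic u, v with derivatives u1, v1 and b = 1 - a, the brackets are the
  Laplacians of \<open>N powr b\<close> and \<open>Q powr b\<close> divided by 4 * b (see
  \<open>energy_laplacian\<close>). This is therefore the subharmonicity of
  \<open>Q powr b / (2 * b - 1) - N powr b\<close> as a statement about four complex
  numbers.\<close>

lemma levi_form_ineq:
  fixes u v u1 v1 :: complex and a \<epsilon> :: real
  defines "Q \<equiv> \<epsilon> + (cmod (u + cnj v))\<^sup>2"
    and "N \<equiv> \<epsilon> + ((cmod u)\<^sup>2 + (cmod v)\<^sup>2)"
    and "t \<equiv> (cmod u1)\<^sup>2 + (cmod v1)\<^sup>2"
  assumes a: "0 \<le> a" "a \<le> 1/2" and \<epsilon>: "0 < \<epsilon>"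
  shows "(1 - 2 * a) * (N powr (- a) * (t - a * (cmod (cnj u * u1 + cnj v * v1))\<^sup>2 / N))
    \<le> Q powr (- a) * (t - a * (cmod (cnj (u + cnj v) * u1 + (u + cnj v) * v1))\<^sup>2 / Q)"
proof -
  \<comment> \<open>X and X + Y are the complex derivatives of N and Q: since |u + cnj v|^2 = |u|^2
    + |v|^2 + 2 Re (u v), they differ by Y, the derivative of u v.\<close>
  define X Y where "X = cnj u * u1 + cnj v * v1" and "Y = v * u1 + u * v1"
  have XY: "cnj (u + cnj v) * u1 + (u + cnj v) * v1 = X + Y"
    by (simp add: X_def Y_def algebra_simps)
  have CS: "(cmod (b * u1 + c * v1))\<^sup>2 \<le> ((cmod b)\<^sup>2 + (cmod c)\<^sup>2) * t" for b c
  proof -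
    have "(cmod (b * u1 + c * v1))\<^sup>2 \<le> (cmod b * cmod u1 + cmod c * cmod v1)\<^sup>2"
      by (intro power_mono) (auto intro: norm_triangle_le simp: norm_mult)
    \<comment> \<open>Lagrange's identity; the added square is exactly what Cauchy-Schwarz
      discards.\<close>
    also have "\<dots> + (cmod b * cmod v1 - cmod c * cmod u1)\<^sup>2 = ((cmod b)\<^sup>2 + (cmod c)\<^sup>2) * t"
      unfolding t_def by algebra
    finally show ?thesis by (smt (verit) zero_le_power2)
  qed
  have par: "(cmod (b + c))\<^sup>2 \<le> 2 * ((cmod b)\<^sup>2 + (cmod c)\<^sup>2)" for b c
  proof -
    have "(cmod (b + c))\<^sup>2 \<le> (cmod b + cmod c)\<^sup>2"
      by (intro power_mono norm_triangle_ineq) auto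
    also have "\<dots> + (cmod b - cmod c)\<^sup>2 = 2 * ((cmod b)\<^sup>2 + (cmod c)\<^sup>2)" by algebra
    finally show ?thesis by (smt (verit) zero_le_power2)
  qed
  have N: "0 < N" and Q: "0 < Q"
    using \<epsilon> by (auto simp: N_def Q_def add_pos_nonneg)
  have t: "0 \<le> t" by (simp add: t_def)
  have QN: "Q \<le> 2 * N"
    using par[of u "cnj v"] \<epsilon> by (simp add: Q_def N_def)
  have uvN: "((cmod u)\<^sup>2 + (cmod v)\<^sup>2) * t \<le> N * t"
    using t \<epsilon> by (intro mult_right_mono) (auto simp: N_def)
  have X: "(cmod X)\<^sup>2 \<le> N * t"
    using CS[of "cnj u" "cnj v"] uvN by (simp add: X_def)
  have Y: "(cmod Y)\<^sup>2 \<le> N * t"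
    using CS[of v u] uvN by (simp add: Y_def add.commute)
  have "(cmod (X + Y))\<^sup>2 \<le> ((cmod (u + cnj v))\<^sup>2 + (cmod (u + cnj v))\<^sup>2) * t"
    using CS[of "cnj (u + cnj v)" "u + cnj v"] unfolding XY complex_mod_cnj .
  also have "\<dots> \<le> (2 * Q) * t"
    using t \<epsilon> by (intro mult_right_mono) (auto simp: Q_def)
  finally have B1: "(cmod (X + Y))\<^sup>2 / Q \<le> 2 * t"
    using Q by (simp add: field_simps)
  have "(cmod (X + Y))\<^sup>2 / N \<le> 2 * ((cmod X)\<^sup>2 / N + t)"
    using par[of X Y] Y N by (simp add: field_simps)
  then have B2: "(Q / N) * ((cmod (X + Y))\<^sup>2 / Q) \<le> 2 * ((cmod X)\<^sup>2 / N + t)"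
    using Q by simp
  have "(1 - 2 * a) * (Q / N) powr a * (t - a * ((cmod X)\<^sup>2 / N)) \<le> t - a * ((cmod (X + Y))\<^sup>2 / Q)"
    using a N Q QN t X B1 B2 by (intro levi_kernel_ineq) (auto simp: field_simps)
  then have "Q powr (- a) * ((1 - 2 * a) * (Q / N) powr a * (t - a * ((cmod X)\<^sup>2 / N)))
      \<le> Q powr (- a) * (t - a * ((cmod (X + Y))\<^sup>2 / Q))"
    by (intro mult_left_mono) auto
  moreover have "Q powr (- a) * (Q / N) powr a = N powr (- a)"
    using Q N by (simp add: powr_divide powr_minus field_simps)
  ultimately show ?thesis
    unfolding XY X_def[symmetric] by (simp add: mult_ac) (metis mult.assoc mult.commute)
qed

subsection \<open>Means of subharmonic functions\<close>

lemma continuous_on_curried: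
  assumes "continuous_on UNIV (\<lambda>(s, \<theta>). f s \<theta>)"
  shows "continuous_on S (f s)"
proof -
  have "continuous_on S (\<lambda>x. (s, x))"
    by (rule continuous_on_Pair[OF continuous_on_const continuous_on_id])
  from continuous_on_compose2[OF assms this] show ?thesis by simp
qed

lemma has_real_derivative_integral:
  fixes f f' :: "real \<Rightarrow> real \<Rightarrow> real"
  assumes "\<And>s S. continuous_on S (f s)" and "continuous_on UNIV (\<lambda>(s, \<theta>). f' s \<theta>)"
    and "\<And>s \<theta>. ((\<lambda>s. f s \<theta>) has_real_derivative f' s \<theta>) (at s)"
  shows "((\<lambda>s. integral {a..b} (f s)) has_real_derivative integral {a..b} (f' s)) (at s)"
proof -
  have "((\<lambda>x. integral (cbox a b) (f x)) has_field_derivative integral (cbox a b) (f' s))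
          (at s within UNIV)"
    by (rule leibniz_rule_field_derivative)
      (rule assms integrable_continuous continuous_on_subset[OF assms(2) subset_UNIV]
         UNIV_I convex_UNIV)+
  then show ?thesis by simp
qed

text \<open>In the coordinate \<open>\<zeta> = s + i\<theta>\<close> with \<open>w = e\<^sup>\<zeta>\<close>, circular means are integrals over a period,
  and their second \<open>s\<close>-derivative is the mean of the Laplacian, since \<open>G\<^sub>\<theta>\<^sub>\<theta>\<close> integrates to zero.
  A convex function bounded at \<open>-\<infinity>\<close> is nondecreasing.\<close>

lemma submean_value_polar:
  fixes g :: "complex \<Rightarrow> real" and Gs Gss Gt Gtt :: "real \<Rightarrow> real \<Rightarrow> real"
  defines "G \<equiv> \<lambda>s \<theta>. g (exp (Complex s \<theta>))"
  assumes g: "continuous_on UNIV g"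
    and Gs: "\<And>s \<theta>. ((\<lambda>s. G s \<theta>) has_real_derivative Gs s \<theta>) (at s)"
    and Gss: "\<And>s \<theta>. ((\<lambda>s. Gs s \<theta>) has_real_derivative Gss s \<theta>) (at s)"
    and Gt: "\<And>s \<theta>. ((\<lambda>\<theta>. G s \<theta>) has_real_derivative Gt s \<theta>) (at \<theta>)"
    and Gtt: "\<And>s \<theta>. ((\<lambda>\<theta>. Gt s \<theta>) has_real_derivative Gtt s \<theta>) (at \<theta>)"
    and cs: "continuous_on UNIV (\<lambda>(s, \<theta>). Gs s \<theta>)"
    and css: "continuous_on UNIV (\<lambda>(s, \<theta>). Gss s \<theta>)"
    and per: "\<And>s. Gt s (2 * pi) = Gt s 0"
    and sub: "\<And>s \<theta>. 0 \<le> Gss s \<theta> + Gtt s \<theta>"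
  shows "2 * pi * g 0 \<le> integral {0..2 * pi} (\<lambda>\<theta>. g (cis \<theta>))"
proof -
  define M where "M s = integral {0..2 * pi} (G s)" for s
  define M1 where "M1 s = integral {0..2 * pi} (Gs s)" for s
  define M2 where "M2 s = integral {0..2 * pi} (Gss s)" for s
  have contG: "continuous_on S (G s)" for s S
    unfolding G_def
    by (rule continuous_on_compose2[OF g]) (auto intro!: continuous_intros simp: Complex_eq simp del: of_real_add of_real_mult)
  note contGs = continuous_on_curried[OF cs] and contGss = continuous_on_curried[OF css]
  have M: "(M has_real_derivative M1 s) (at s)" for s
    unfolding M_def[abs_def] M1_def by (rule has_real_derivative_integral[OF contG cs Gs])
  have M1: "(M1 has_real_derivative M2 s) (at s)" for s
    unfolding M1_def[abs_def] M2_def by (rule has_real_derivative_integral[OF contGs css Gss])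
  have M2_nonneg: "0 \<le> M2 s" for s
  proof -
    have "((\<lambda>\<theta>. Gtt s \<theta>) has_integral (Gt s (2 * pi) - Gt s 0)) {0..2 * pi}"
    proof (rule fundamental_theorem_of_calculus)
      fix \<theta> show "(Gt s has_vector_derivative Gtt s \<theta>) (at \<theta> within {0..2 * pi})"
        using has_field_derivative_at_within[OF Gtt]
        by (simp only: has_real_derivative_iff_has_vector_derivative)
    qed simp
    moreover have "(Gss s has_integral M2 s) {0..2 * pi}"
      unfolding M2_def by (rule integrable_integral[OF integrable_continuous_real[OF contGss]])
    ultimately have "((\<lambda>\<theta>. Gss s \<theta> + Gtt s \<theta>) has_integral M2 s + (Gt s (2 * pi) - Gt s 0)) {0..2 * pi}"
      by (intro has_integral_add)
    then have "((\<lambda>\<theta>. Gss s \<theta> + Gtt s \<theta>) has_integral M2 s) {0..2 * pi}"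
      by (simp only: per diff_self add_0_right)
    then show ?thesis by (rule has_integral_nonneg) (use sub in auto)
  qed
  have mono1: "M1 s \<le> M1 s'" if "s \<le> s'" for s s'
    using DERIV_nonneg_imp_nondecreasing[OF that, of M1] M1 M2_nonneg by blast
  obtain K where K: "\<And>w. norm w \<le> 1 \<Longrightarrow> \<bar>g w\<bar> \<le> K"
  proof -
    have "compact (g ` cball 0 1)"
      by (intro compact_continuous_image continuous_on_subset[OF g]) auto
    then obtain K where "\<forall>x\<in>g ` cball 0 1. norm x \<le> K"
      using compact_imp_bounded bounded_iff by blast
    then show ?thesis using that[of K] by auto
  qed
  have norm_exp: "norm (exp (Complex s \<theta>)) = exp s" for s \<theta> by simp
  have Mbound: "\<bar>M s\<bar> \<le> K * (2 * pi)" if "s \<le> 0" for s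
  proof -
    have "norm (G s \<theta>) \<le> K" for \<theta>
      using that by (simp add: G_def K)
    then show ?thesis
      using integral_bound[OF _ contG, of 0 "2 * pi" s K] by (simp add: M_def)
  qed
  have M1_nonneg: "0 \<le> M1 s" if "s \<le> 0" for s
  proof (rule ccontr)
    assume neg: "\<not> 0 \<le> M1 s"
    \<comment> \<open>Since M1 is nondecreasing, a negative slope at s is at least as steep
      everywhere to its left. Over the length h it forces a drop of 2 * K * (2 * pi) + 1, more than
      the bound on M over the left half-line allows.\<close>
    define h where "h = (2 * K * (2 * pi) + 1) / (- M1 s)"
    have "0 \<le> K" using K[of 0] by auto
    then have "0 < 2 * K * (2 * pi) + 1" by (intro add_nonneg_pos) auto
    then have h: "0 < h" using neg unfolding h_def by (intro divide_pos_pos) auto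
    obtain z where z: "s - h < z" "z < s" and eq: "M s - M (s - h) = (s - (s - h)) * M1 z"
      using MVT2[of "s - h" s M M1] h M by auto
    have "h * M1 z \<le> h * M1 s"
      using mono1[of z s] z h by (intro mult_left_mono) auto
    also have "h * M1 s = - (2 * K * (2 * pi) + 1)"
      using neg by (simp add: h_def field_simps)
    finally have "M s - M (s - h) \<le> - (2 * K * (2 * pi) + 1)"
      using eq by simp
    moreover have "\<bar>M s\<bar> \<le> K * (2 * pi)" "\<bar>M (s - h)\<bar> \<le> K * (2 * pi)"
      using Mbound that h by auto
    ultimately show False by (auto simp: abs_le_iff)
  qed
  have mono: "M s \<le> M 0" if "s \<le> 0" for s
    using DERIV_nonneg_imp_nondecreasing[OF that, of M] M M1_nonneg by blast
  have "2 * pi * (g 0 - e) \<le> M 0" if "0 < e" for e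
  proof -
    obtain d where d: "0 < d" "\<And>w. norm w < d \<Longrightarrow> \<bar>g w - g 0\<bar> < e"
      using g \<open>0 < e\<close> unfolding continuous_on_iff dist_norm by (metis UNIV_I diff_zero real_norm_def)
    \<comment> \<open>The circle of radius exp s lies within distance d / 2 of the origin, and s
      \<le> 0 makes the monotonicity of M up to 0 applicable.\<close>
    define s where "s = min 0 (ln (d / 2))"
    have "exp s \<le> d / 2"
      using d by (metis exp_le_cancel_iff exp_ln half_gt_zero min.cobounded2 s_def)
    then have "g 0 - e \<le> G s \<theta>" for \<theta>
      using d(2)[of "exp (Complex s \<theta>)"] d(1) unfolding norm_exp G_def by auto
    then have "integral {0..2 * pi} (\<lambda>_. g 0 - e) \<le> M s"
      unfolding M_def by (intro integral_le integrable_continuous_real contG) auto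
    also have "\<dots> \<le> M 0" by (rule mono) (simp add: s_def)
    finally show ?thesis by (simp add: mult.commute)
  qed
  then have "2 * pi * g 0 - e \<le> M 0" if "0 < e" for e
    using that[THEN divide_pos_pos, of "2 * pi"] by (force simp: right_diff_distrib)
  then have "2 * pi * g 0 \<le> M 0"
    by (meson field_le_epsilon diff_le_eq)
  moreover have "G 0 = (\<lambda>\<theta>. g (cis \<theta>))"
    by (auto simp: G_def cis_conv_exp Complex_eq fun_eq_iff)
  ultimately show ?thesis by (simp add: M_def)
qed

section \<open>Calculus of the regularised powers\<close>

text \<open>With b = p / 2 this regularises the p-th power of the norm; for \<epsilon> > 0 the base
  never vanishes. A general inner product space lets one calculus serve both the complex value u +
  cnj v and the pair (u, v).\<close>

definition energy :: "real \<Rightarrow> real \<Rightarrow> 'a::real_inner \<Rightarrow> real" where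
  "energy \<epsilon> b x = (\<epsilon> + x \<bullet> x) powr b"

text \<open>\<open>energy'\<close> and \<open>energy''\<close> are the first and second derivatives
  of \<open>energy\<close> along a curve at the point x with velocity x1 and, for the second,
  acceleration x2.\<close>

definition energy' :: "real \<Rightarrow> real \<Rightarrow> 'a::real_inner \<Rightarrow> 'a \<Rightarrow> real" where
  "energy' \<epsilon> b x x1 = 2 * b * (\<epsilon> + x \<bullet> x) powr (b - 1) * (x \<bullet> x1)"

definition energy'' :: "real \<Rightarrow> real \<Rightarrow> 'a::real_inner \<Rightarrow> 'a \<Rightarrow> 'a \<Rightarrow> real" where
  "energy'' \<epsilon> b x x1 x2 = 2 * b * (2 * (b - 1) * (\<epsilon> + x \<bullet> x) powr (b - 2) * (x \<bullet> x1)\<^sup>2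
     + (\<epsilon> + x \<bullet> x) powr (b - 1) * (x1 \<bullet> x1 + x \<bullet> x2))"

lemma add_inner_self_pos: "0 < (\<epsilon>::real) \<Longrightarrow> 0 < \<epsilon> + x \<bullet> x"
  by (simp add: add_pos_nonneg)

lemma add_inner_self_nonzero: "0 < (\<epsilon>::real) \<Longrightarrow> \<epsilon> + x \<bullet> x \<noteq> 0"
  using add_inner_self_pos[of \<epsilon> x] by simp

lemma inner_has_real_derivative:
  assumes "(f has_vector_derivative f') (at s)" "(g has_vector_derivative g') (at s)"
  shows "((\<lambda>s. f s \<bullet> g s) has_real_derivative f s \<bullet> g' + f' \<bullet> g s) (at s)"
  using bounded_bilinear.has_vector_derivative[OF bounded_bilinear_inner assms]
  by (simp add: has_real_derivative_iff_has_vector_derivative)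

lemma inner_self_has_real_derivative:
  assumes "(f has_vector_derivative f') (at s)"
  shows "((\<lambda>s. \<epsilon> + f s \<bullet> f s) has_real_derivative 2 * (f s \<bullet> f')) (at s)"
  by (rule derivative_eq_intros inner_has_real_derivative assms refl)+ (simp add: inner_commute)

lemma energy_has_derivative:
  assumes "0 < \<epsilon>" "(f has_vector_derivative f1) (at s)"
  shows "((\<lambda>s. energy \<epsilon> b (f s)) has_real_derivative energy' \<epsilon> b (f s) f1) (at s)"
  unfolding energy_def energy'_def
  by (rule DERIV_cong[OF DERIV_powr[OF inner_self_has_real_derivative[OF assms(2)]
        add_inner_self_pos[OF assms(1)] DERIV_const]])
     (use add_inner_self_pos[OF assms(1), of "f s"] in \<open>simp add: powr_diff\<close>)

lemma energy'_has_derivative: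
  assumes \<epsilon>: "0 < \<epsilon>" and f: "(f has_vector_derivative f1 s) (at s)"
    and f1: "(f1 has_vector_derivative f2) (at s)"
  shows "((\<lambda>s. energy' \<epsilon> b (f s) (f1 s)) has_real_derivative energy'' \<epsilon> b (f s) (f1 s) f2) (at s)"
proof -
  have pos: "0 < \<epsilon> + f s \<bullet> f s" by (rule add_inner_self_pos[OF \<epsilon>])
  have "((\<lambda>s. (\<epsilon> + f s \<bullet> f s) powr (b - 1)) has_real_derivative
      (b - 1) * (\<epsilon> + f s \<bullet> f s) powr (b - 2) * (2 * (f s \<bullet> f1 s))) (at s)"
    by (rule DERIV_cong[OF DERIV_powr[OF inner_self_has_real_derivative[OF f] pos DERIV_const]])
       (use pos in \<open>simp add: powr_diff power2_eq_square\<close>)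
  from DERIV_mult[OF DERIV_cmult[OF this, of "2 * b"] inner_has_real_derivative[OF f f1]]
  show ?thesis
    unfolding energy'_def energy''_def
    by (rule DERIV_cong) (simp add: algebra_simps power2_eq_square)
qed

lemma continuous_on_energy [continuous_intros]:
  assumes "0 < \<epsilon>" "continuous_on S f"
  shows "continuous_on S (\<lambda>x. energy \<epsilon> b (f x))"
  unfolding energy_def
  by (intro continuous_intros assms ballI add_inner_self_nonzero)

lemma continuous_on_energy' [continuous_intros]:
  assumes "0 < \<epsilon>" "continuous_on S f" "continuous_on S g"
  shows "continuous_on S (\<lambda>x. energy' \<epsilon> b (f x) (g x))"
  unfolding energy'_def
  by (intro continuous_intros assms ballI add_inner_self_nonzero)

lemma continuous_on_energy'' [continuous_intros]:
  assumes "0 < \<epsilon>" "continuous_on S f" "continuous_on S g" "continuous_on S h"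
  shows "continuous_on S (\<lambda>x. energy'' \<epsilon> b (f x) (g x) (h x))"
  unfolding energy''_def
  by (intro continuous_intros assms ballI add_inner_self_nonzero)

text \<open>Harmonicity \<open>xss + xtt = 0\<close> cancels the acceleration terms, so only first
  derivatives remain. The normalisation 2 * t makes t equal to |u'|^2 + |v'|^2 in both applications,
  matching \<open>levi_form_ineq\<close> with a = 1 - b.\<close>

lemma energy_laplacian:
  assumes "0 < \<epsilon>" "xss + xtt = 0" and t: "xs \<bullet> xs + xt \<bullet> xt = 2 * t"
  shows "energy'' \<epsilon> b x xs xss + energy'' \<epsilon> b x xt xtt =
    4 * b * ((\<epsilon> + x \<bullet> x) powr (- (1 - b)) *
      (t - (1 - b) * ((x \<bullet> xs)\<^sup>2 + (x \<bullet> xt)\<^sup>2) / (\<epsilon> + x \<bullet> x)))"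
proof -
  have xtt: "xtt = - xss" using assms(2) by (simp add: eq_neg_iff_add_eq_0 add.commute)
  define Q where "Q = \<epsilon> + x \<bullet> x"
  have "0 < Q" using add_inner_self_pos[OF assms(1), of x] by (simp add: Q_def)
  then have 2: "Q powr (b - 2) = Q powr (b - 1) / Q"
    by (simp add: powr_diff power2_eq_square)
  have t': "xt \<bullet> xt = 2 * t - xs \<bullet> xs" using t by simp
  show ?thesis
    using \<open>0 < Q\<close> unfolding energy''_def xtt minus_diff_eq Q_def[symmetric] t' 2
    by (simp add: field_simps)
qed

section \<open>Polynomials in the logarithmic coordinate\<close>

text \<open>The Euler operator w d/dw, which is d/d\<zeta> for w = exp \<zeta>. Derivatives in the
  logarithmic coordinate thus remain polynomials in w.\<close>

definition euler_deriv :: "complex poly \<Rightarrow> complex poly" where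
  "euler_deriv p = pCons 0 (pderiv p)"

lemma poly_exp_has_derivative_radial:
  "((\<lambda>s. poly p (exp (Complex s \<theta>))) has_vector_derivative
     poly (euler_deriv p) (exp (Complex s \<theta>))) (at s)"
proof -
  have "((\<lambda>s. Complex s \<theta>) has_vector_derivative 1) (at s)"
    unfolding Complex_eq by (auto intro!: derivative_eq_intros simp: scaleR_conv_of_real)
  moreover have "((\<lambda>\<zeta>. poly p (exp \<zeta>)) has_field_derivative poly (pderiv p) (exp \<zeta>) * exp \<zeta>) (at \<zeta>)"
    for \<zeta> :: complex
    by (auto intro!: derivative_eq_intros DERIV_chain2[OF poly_DERIV])
  ultimately show ?thesis
    using field_vector_diff_chain_at[of "\<lambda>s. Complex s \<theta>" 1 s "\<lambda>\<zeta>. poly p (exp \<zeta>)"]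
    by (simp add: o_def euler_deriv_def mult.commute)
qed

lemma poly_exp_has_derivative_angular:
  "((\<lambda>\<theta>. poly p (exp (Complex s \<theta>))) has_vector_derivative
     \<i> * poly (euler_deriv p) (exp (Complex s \<theta>))) (at \<theta>)"
proof -
  have "((\<lambda>\<theta>. Complex s \<theta>) has_vector_derivative \<i>) (at \<theta>)"
    unfolding Complex_eq by (auto intro!: derivative_eq_intros simp: scaleR_conv_of_real)
  moreover have "((\<lambda>\<zeta>. poly p (exp \<zeta>)) has_field_derivative poly (pderiv p) (exp \<zeta>) * exp \<zeta>) (at \<zeta>)"
    for \<zeta> :: complex
    by (auto intro!: derivative_eq_intros DERIV_chain2[OF poly_DERIV])
  ultimately have "((\<lambda>\<zeta>. poly p (exp \<zeta>)) \<circ> Complex s has_vector_derivative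
      \<i> * (poly (pderiv p) (exp (Complex s \<theta>)) * exp (Complex s \<theta>))) (at \<theta>)"
    by (rule field_vector_diff_chain_at)
  then show ?thesis
    by (simp add: o_def euler_deriv_def mult_ac)
qed

lemma continuous_on_exp_Complex:
  assumes "continuous_on UNIV h"
  shows "continuous_on UNIV (\<lambda>(s, \<theta>). h (exp (Complex s \<theta>)))"
  unfolding split_beta
  by (rule continuous_on_compose2[OF assms]) (auto simp: Complex_eq intro!: continuous_intros)

text \<open>With b = p / 2 the constant is 1 / (p - 1). \<open>submean_value_polar\<close> is
  applied to C times the energy of u + cnj v minus the energy of (u, v);
  \<open>levi_form_ineq\<close> with a = 1 - b makes the Laplacian nonnegative.\<close>

lemma integral_energy_le:
  fixes U V :: "complex poly" and b \<epsilon> :: real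
  assumes V0: "poly V 0 = 0" and b: "1/2 < b" "b \<le> 1" and \<epsilon>: "0 < \<epsilon>"
  shows "integral {0..2 * pi} (\<lambda>\<theta>. energy \<epsilon> b (poly U (cis \<theta>), poly V (cis \<theta>)))
       \<le> 1 / (2 * b - 1) * integral {0..2 * pi} (\<lambda>\<theta>. energy \<epsilon> b (poly U (cis \<theta>) + cnj (poly V (cis \<theta>))))"
proof -
  define C where "C = 1 / (2 * b - 1)"
  define u u1 u2 where "u = poly U" and "u1 = poly (euler_deriv U)"
    and "u2 = poly (euler_deriv (euler_deriv U))"
  define v v1 v2 where "v = poly V" and "v1 = poly (euler_deriv V)"
    and "v2 = poly (euler_deriv (euler_deriv V))"
  note uv_defs = u_def u1_def u2_def v_def v1_def v2_def
  let ?e = "\<lambda>s \<theta>. exp (Complex s \<theta>)"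
  \<comment> \<open>The suffixes s and t mark derivatives in the radial and angular coordinates of
    exp (s + i \<theta>). Each angular derivative multiplies u and v by \<i>, inside the conjugation
    in the case of cnj v.\<close>
  define f fs ft fss ftt where "f w = u w + cnj (v w)" and "fs w = u1 w + cnj (v1 w)"
    and "ft w = \<i> * u1 w + cnj (\<i> * v1 w)" and "fss w = u2 w + cnj (v2 w)"
    and "ftt w = \<i> * (\<i> * u2 w) + cnj (\<i> * (\<i> * v2 w))" for w
  define n ns nt nss ntt where "n w = (u w, v w)" and "ns w = (u1 w, v1 w)"
    and "nt w = (\<i> * u1 w, \<i> * v1 w)" and "nss w = (u2 w, v2 w)"
    and "ntt w = (\<i> * (\<i> * u2 w), \<i> * (\<i> * v2 w))" for w
  note fn_defs = f_def fs_def ft_def fss_def ftt_def n_def ns_def nt_def nss_def ntt_def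
  note der = poly_exp_has_derivative_radial poly_exp_has_derivative_angular
     has_vector_derivative_add has_vector_derivative_cnj has_vector_derivative_Pair
     has_vector_derivative_mult_right
  have dfs: "((\<lambda>s. f (?e s \<theta>)) has_vector_derivative fs (?e s \<theta>)) (at s)"
    and dfss: "((\<lambda>s. fs (?e s \<theta>)) has_vector_derivative fss (?e s \<theta>)) (at s)"
    and dft: "((\<lambda>\<theta>. f (?e s \<theta>)) has_vector_derivative ft (?e s \<theta>)) (at \<theta>)"
    and dftt: "((\<lambda>\<theta>. ft (?e s \<theta>)) has_vector_derivative ftt (?e s \<theta>)) (at \<theta>)"
    and dns: "((\<lambda>s. n (?e s \<theta>)) has_vector_derivative ns (?e s \<theta>)) (at s)"
    and dnss: "((\<lambda>s. ns (?e s \<theta>)) has_vector_derivative nss (?e s \<theta>)) (at s)"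
    and dnt: "((\<lambda>\<theta>. n (?e s \<theta>)) has_vector_derivative nt (?e s \<theta>)) (at \<theta>)"
    and dntt: "((\<lambda>\<theta>. nt (?e s \<theta>)) has_vector_derivative ntt (?e s \<theta>)) (at \<theta>)" for s \<theta>
    unfolding fn_defs uv_defs by (rule der)+
  have cont: "continuous_on UNIV f" "continuous_on UNIV fs" "continuous_on UNIV fss"
    "continuous_on UNIV n" "continuous_on UNIV ns" "continuous_on UNIV nss"
    unfolding fn_defs uv_defs by (intro continuous_intros)+
  define g where "g w = C * energy \<epsilon> b (f w) - energy \<epsilon> b (n w)" for w
  define gs where "gs w = C * energy' \<epsilon> b (f w) (fs w) - energy' \<epsilon> b (n w) (ns w)" for w
  define gt where "gt w = C * energy' \<epsilon> b (f w) (ft w) - energy' \<epsilon> b (n w) (nt w)" for w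
  define gss where "gss w = C * energy'' \<epsilon> b (f w) (fs w) (fss w) - energy'' \<epsilon> b (n w) (ns w) (nss w)" for w
  define gtt where "gtt w = C * energy'' \<epsilon> b (f w) (ft w) (ftt w) - energy'' \<epsilon> b (n w) (nt w) (ntt w)" for w
  have laplacian_nonneg: "0 \<le> gss w + gtt w" for w
  proof -
    define t where "t = (cmod (u1 w))\<^sup>2 + (cmod (v1 w))\<^sup>2"
    let ?X = "cnj (u w) * u1 w + cnj (v w) * v1 w"
    let ?Z = "cnj (f w) * u1 w + f w * v1 w"
    let ?Q = "\<epsilon> + (cmod (f w))\<^sup>2" and ?N = "\<epsilon> + ((cmod (u w))\<^sup>2 + (cmod (v w))\<^sup>2)"
    have lap_f: "energy'' \<epsilon> b (f w) (fs w) (fss w) + energy'' \<epsilon> b (f w) (ft w) (ftt w) =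
      4 * b * (?Q powr (- (1 - b)) * (t - (1 - b) * (cmod ?Z)\<^sup>2 / ?Q))"
    proof (subst energy_laplacian[OF \<epsilon>, where t = t])
      show "fs w \<bullet> fs w + ft w \<bullet> ft w = 2 * t"
        unfolding t_def cmod_power2
        by (simp add: fn_defs inner_complex_def power2_eq_square algebra_simps)
      \<comment> \<open>The two inner products are Re Z and Re (\<i> Z) = - Im Z. The same
        computation yields X for the pair (u, v) below.\<close>
      have "(f w \<bullet> fs w)\<^sup>2 + (f w \<bullet> ft w)\<^sup>2 = (cmod ?Z)\<^sup>2"
        unfolding cmod_power2
        by (simp add: fs_def ft_def inner_complex_def power2_eq_square algebra_simps)
      then show "4 * b * ((\<epsilon> + f w \<bullet> f w) powr - (1 - b) *
         (t - (1 - b) * ((f w \<bullet> fs w)\<^sup>2 + (f w \<bullet> ft w)\<^sup>2) / (\<epsilon> + f w \<bullet> f w))) =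
        4 * b * (?Q powr - (1 - b) * (t - (1 - b) * (cmod ?Z)\<^sup>2 / ?Q))"
        by (simp add: power2_norm_eq_inner)
    qed (simp add: fn_defs zero_prod_def)
    have lap_n: "energy'' \<epsilon> b (n w) (ns w) (nss w) + energy'' \<epsilon> b (n w) (nt w) (ntt w) =
      4 * b * (?N powr (- (1 - b)) * (t - (1 - b) * (cmod ?X)\<^sup>2 / ?N))"
    proof (subst energy_laplacian[OF \<epsilon>, where t = t])
      show "ns w \<bullet> ns w + nt w \<bullet> nt w = 2 * t"
        unfolding t_def cmod_power2
        by (simp add: fn_defs inner_complex_def power2_eq_square algebra_simps)
      have "(n w \<bullet> ns w)\<^sup>2 + (n w \<bullet> nt w)\<^sup>2 = (cmod ?X)\<^sup>2"
        unfolding cmod_power2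
        by (simp add: fn_defs inner_complex_def power2_eq_square algebra_simps)
      moreover have "n w \<bullet> n w = (cmod (u w))\<^sup>2 + (cmod (v w))\<^sup>2"
        by (simp add: n_def power2_norm_eq_inner)
      ultimately show "4 * b * ((\<epsilon> + n w \<bullet> n w) powr - (1 - b) *
         (t - (1 - b) * ((n w \<bullet> ns w)\<^sup>2 + (n w \<bullet> nt w)\<^sup>2) / (\<epsilon> + n w \<bullet> n w))) =
        4 * b * (?N powr - (1 - b) * (t - (1 - b) * (cmod ?X)\<^sup>2 / ?N))"
        by simp
    qed (simp add: fn_defs zero_prod_def)
    have "(2 * b - 1) * (?N powr (- (1 - b)) * (t - (1 - b) * (cmod ?X)\<^sup>2 / ?N))
        \<le> ?Q powr (- (1 - b)) * (t - (1 - b) * (cmod ?Z)\<^sup>2 / ?Q)"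
      using levi_form_ineq[of "1 - b" \<epsilon> "u w" "v w" "u1 w" "v1 w"] b \<epsilon>
      by (simp add: f_def t_def)
    then have "?N powr (- (1 - b)) * (t - (1 - b) * (cmod ?X)\<^sup>2 / ?N)
        \<le> C * (?Q powr (- (1 - b)) * (t - (1 - b) * (cmod ?Z)\<^sup>2 / ?Q))"
      using b by (simp add: C_def field_simps)
    then have "4 * b * (?N powr (- (1 - b)) * (t - (1 - b) * (cmod ?X)\<^sup>2 / ?N))
        \<le> 4 * b * (C * (?Q powr (- (1 - b)) * (t - (1 - b) * (cmod ?Z)\<^sup>2 / ?Q)))"
      using b by (intro mult_left_mono) auto
    then have "0 \<le> C * (energy'' \<epsilon> b (f w) (fs w) (fss w) + energy'' \<epsilon> b (f w) (ft w) (ftt w))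
        - (energy'' \<epsilon> b (n w) (ns w) (nss w) + energy'' \<epsilon> b (n w) (nt w) (ntt w))"
      unfolding lap_f lap_n by (simp only: mult.left_commute[of C] diff_ge_0_iff_ge)
    then show ?thesis
      unfolding gss_def gtt_def by (simp add: distrib_left)
  qed
  have "2 * pi * g 0 \<le> integral {0..2 * pi} (\<lambda>\<theta>. g (cis \<theta>))"
  proof (rule submean_value_polar)
    show "continuous_on UNIV g" unfolding g_def by (intro continuous_intros cont \<epsilon>)
    show "((\<lambda>s. g (?e s \<theta>)) has_real_derivative gs (?e s \<theta>)) (at s)" for s \<theta>
      unfolding g_def gs_def
      by (intro DERIV_diff DERIV_cmult energy_has_derivative \<epsilon> dfs dns)
    show "((\<lambda>s. gs (?e s \<theta>)) has_real_derivative gss (?e s \<theta>)) (at s)" for s \<theta>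
      unfolding gs_def gss_def
      by (intro DERIV_diff DERIV_cmult energy'_has_derivative \<epsilon> dfs dns dfss dnss)
    show "((\<lambda>\<theta>. g (?e s \<theta>)) has_real_derivative gt (?e s \<theta>)) (at \<theta>)" for s \<theta>
      unfolding g_def gt_def
      by (intro DERIV_diff DERIV_cmult energy_has_derivative \<epsilon> dft dnt)
    show "((\<lambda>\<theta>. gt (?e s \<theta>)) has_real_derivative gtt (?e s \<theta>)) (at \<theta>)" for s \<theta>
      unfolding gt_def gtt_def
      by (intro DERIV_diff DERIV_cmult energy'_has_derivative \<epsilon> dft dnt dftt dntt)
    show "continuous_on UNIV (\<lambda>(s, \<theta>). gs (?e s \<theta>))"
      unfolding gs_def by (intro continuous_on_exp_Complex continuous_intros cont \<epsilon>)
    show "continuous_on UNIV (\<lambda>(s, \<theta>). gss (?e s \<theta>))"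
      unfolding gss_def by (intro continuous_on_exp_Complex continuous_intros cont \<epsilon>)
    have "?e s (2 * pi) = ?e s 0" for s by (simp add: exp_eq_polar complex_eq_iff)
    then show "gt (?e s (2 * pi)) = gt (?e s 0)" for s by simp
    show "0 \<le> gss (?e s \<theta>) + gtt (?e s \<theta>)" for s \<theta> by (rule laplacian_nonneg)
  qed
  \<comment> \<open>As V vanishes at 0, the pair (u 0, 0) and the number u 0 have equal energy, so g
    0 is C - 1 \<ge> 0 times that energy.\<close>
  moreover have "0 \<le> g 0"
  proof -
    have "1 \<le> C" using b by (simp add: C_def)
    moreover have "energy \<epsilon> b (n 0) = energy \<epsilon> b (f 0)" "0 \<le> energy \<epsilon> b (f 0)"
      by (auto simp: energy_def f_def n_def v_def V0)
    ultimately show ?thesis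
      by (simp add: g_def mult_le_cancel_right1)
  qed
  moreover have "integral {0..2 * pi} (\<lambda>\<theta>. g (cis \<theta>)) =
      C * integral {0..2 * pi} (\<lambda>\<theta>. energy \<epsilon> b (f (cis \<theta>))) - integral {0..2 * pi} (\<lambda>\<theta>. energy \<epsilon> b (n (cis \<theta>)))"
  proof -
    have "(\<lambda>\<theta>. energy \<epsilon> b (f (cis \<theta>))) integrable_on {0..2 * pi}"
         "(\<lambda>\<theta>. energy \<epsilon> b (n (cis \<theta>))) integrable_on {0..2 * pi}"
      by (intro integrable_continuous_real continuous_on_energy[OF \<epsilon>]
          continuous_on_compose2[OF cont(1)] continuous_on_compose2[OF cont(4)]
          continuous_intros subset_UNIV)+
    moreover from integrable_cmul[OF this(1), of C]
    have "(\<lambda>\<theta>. C * energy \<epsilon> b (f (cis \<theta>))) integrable_on {0..2 * pi}" by simp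
    ultimately show ?thesis
      unfolding g_def by (simp add: integral_diff)
  qed
  ultimately have "integral {0..2 * pi} (\<lambda>\<theta>. energy \<epsilon> b (n (cis \<theta>)))
     \<le> C * integral {0..2 * pi} (\<lambda>\<theta>. energy \<epsilon> b (f (cis \<theta>)))"
    using mult_nonneg_nonneg[of "2 * pi" "g 0"] pi_ge_zero by linarith
  then show ?thesis by (simp add: C_def f_def n_def u_def v_def)
qed

subsection \<open>\<open>L\<^sup>p\<close> norms on the circle\<close>

lemma sets_circle [measurable_cong]: "sets circle = sets (restrict_space borel (sphere 0 1))"
  by (simp add: circle_def)

lemma finite_measure_circle: "finite_measure circle"
  by standard (simp add: emeasure_space_circle)

interpretation circle: finite_measure circle
  by (rule finite_measure_circle)

lemma measure_space_circle [simp]: "measure circle (space circle) = 1"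
  by (simp add: measure_def emeasure_space_circle)

lemma continuous_imp_measurable_circle:
  "continuous_on (sphere 0 1) f \<Longrightarrow> f \<in> borel_measurable circle"
  unfolding measurable_cong_sets[OF sets_circle refl]
  by (rule borel_measurable_continuous_on_restrict)

lemma integral_circle:
  fixes f :: "complex \<Rightarrow> 'a::{banach, second_countable_topology}"
  assumes "f \<in> borel_measurable circle"
  shows "integral\<^sup>L circle f = (1 / (2 * pi)) *\<^sub>R (LINT \<theta>:{0..2 * pi}|lborel. f (cis \<theta>))"
proof -
  have *: "cis \<in> uniform_measure lborel {0..2 * pi} \<rightarrow>\<^sub>M restrict_space borel (sphere 0 1)"
    using measurable_cis_sphere by (simp add: measurable_def)
  have f: "f \<in> borel_measurable (restrict_space borel (sphere 0 1))"
    using assms unfolding measurable_cong_sets[OF sets_circle refl] .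
  have fc: "(\<lambda>\<theta>. f (cis \<theta>)) \<in> borel_measurable borel"
    by (rule measurable_compose[OF measurable_cis_sphere f])
  have U: "uniform_measure lborel {0..2 * pi} =
      density lborel (\<lambda>\<theta>. ennreal (indicator {0..2 * pi} \<theta> / (2 * pi)))"
    unfolding uniform_measure_def
    by (intro density_cong) (auto simp: divide_ennreal[symmetric] split: split_indicator)
  have "integral\<^sup>L circle f = (LINT \<theta>|uniform_measure lborel {0..2 * pi}. f (cis \<theta>))"
    unfolding circle_def by (rule integral_distr[OF * f])
  also have "\<dots> = (LINT \<theta>|lborel. (indicator {0..2 * pi} \<theta> / (2 * pi)) *\<^sub>R f (cis \<theta>))"
    unfolding U by (rule integral_density) (use fc in auto)
  also have "\<dots> = (LINT \<theta>|lborel. (1 / (2 * pi)) *\<^sub>R (indicator {0..2 * pi} \<theta> *\<^sub>R f (cis \<theta>)))"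
    by simp
  also have "\<dots> = (1 / (2 * pi)) *\<^sub>R (LINT \<theta>:{0..2 * pi}|lborel. f (cis \<theta>))"
    unfolding set_lebesgue_integral_def by (rule integral_scaleR_right)
  finally show ?thesis .
qed

lemma integral_circle_continuous:
  fixes f :: "complex \<Rightarrow> 'a::euclidean_space"
  assumes "continuous_on (sphere 0 1) f"
  shows "integral\<^sup>L circle f = (1 / (2 * pi)) *\<^sub>R integral {0..2 * pi} (\<lambda>\<theta>. f (cis \<theta>))"
proof -
  have "continuous_on {0..2 * pi} (\<lambda>\<theta>. f (cis \<theta>))"
    by (rule continuous_on_compose2[OF assms]) (auto intro!: continuous_intros)
  then have "set_integrable lborel {0..2 * pi} (\<lambda>\<theta>. f (cis \<theta>))"
    by (rule borel_integrable_atLeastAtMost')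
  from set_borel_integral_eq_integral(2)[OF this] show ?thesis
    by (simp add: integral_circle continuous_imp_measurable_circle assms)
qed

lemma integrable_circle_bounded:
  fixes f :: "complex \<Rightarrow> 'a::{banach, second_countable_topology}"
  assumes "f \<in> borel_measurable circle" "\<And>z. z \<in> sphere 0 1 \<Longrightarrow> norm (f z) \<le> B"
  shows "integrable circle f"
  by (rule circle.integrable_const_bound[of _ B]) (use assms in \<open>auto simp: space_circle\<close>)

lemma integrable_circle_continuous:
  fixes f :: "complex \<Rightarrow> 'a::{banach, second_countable_topology}"
  assumes "continuous_on (sphere 0 1) f"
  shows "integrable circle f"
proof -
  have "compact (f ` sphere 0 1)" by (intro compact_continuous_image assms compact_sphere)
  then obtain B where "\<forall>x\<in>f ` sphere 0 1. norm x \<le> B"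
    using compact_imp_bounded bounded_iff by blast
  then show ?thesis
    by (intro integrable_circle_bounded[of f B] continuous_imp_measurable_circle assms) auto
qed

section \<open>Minkowski and Hoelder inequalities\<close>

lemma powr_convex_combination:
  fixes l x y p :: real
  assumes p: "1 \<le> p" and l: "0 \<le> l" "l \<le> 1" and xy: "0 \<le> x" "0 \<le> y"
  shows "((1 - l) * x + l * y) powr p \<le> (1 - l) * x powr p + l * y powr p"
proof -
  \<comment> \<open>This handles the boundary cases x = 0 or y = 0, where one term of the
    combination disappears and only its weight has to be compared with its p-th power.\<close>
  have le: "c powr p \<le> c" if "0 \<le> c" "c \<le> 1" for c :: real
    using powr_mono'[of 1 p c] that p by (cases "c = 0") auto
  show ?thesis
  proof (cases "x = 0 \<or> y = 0")
    case True
    then show ?thesis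
      using le[of l] le[of "1 - l"] l xy p
      by (auto simp: powr_mult intro!: mult_right_mono)
  next
    case False
    then show ?thesis
      using powr_convex[OF p] l xy unfolding convex_on_def
      by (auto dest!: bspec[where x = x] bspec[where x = y] spec[where x = "1 - l"] spec[where x = l])
  qed
qed

lemma powr_add_le:
  fixes x y p :: real
  assumes "1 \<le> p" "0 \<le> x" "0 \<le> y"
  shows "(x + y) powr p \<le> 2 powr p * (x powr p + y powr p)"
proof -
  have "(x + y) powr p \<le> (2 * max x y) powr p"
    using assms by (intro powr_mono2) auto
  also have "\<dots> = 2 powr p * (max x y) powr p" using assms by (simp add: powr_mult)
  also have "\<dots> \<le> 2 powr p * (x powr p + y powr p)"
    by (intro mult_left_mono) (auto simp: max_def)
  finally show ?thesis .
qed

lemma Lp_measurable: "f \<in> Lp p \<Longrightarrow> f \<in> borel_measurable circle"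
  and Lp_integrable: "f \<in> Lp p \<Longrightarrow> integrable circle (\<lambda>z. cmod (f z) powr p)"
  by (auto simp: Lp_def)

lemma LpI_bound:
  assumes "g \<in> borel_measurable circle" "integrable circle h"
    and "\<And>z. z \<in> sphere 0 1 \<Longrightarrow> cmod (g z) powr p \<le> h z"
  shows "g \<in> Lp p"
proof -
  have "integrable circle (\<lambda>z. cmod (g z) powr p)"
    by (rule Bochner_Integration.integrable_bound[OF assms(2)])
      (use assms in \<open>auto simp: space_circle intro!: AE_I2 order_trans[OF _ abs_ge_self]\<close>)
  with assms show ?thesis by (simp add: Lp_def)
qed

lemma continuous_on_cmod_powr:
  fixes p :: real
  assumes "continuous_on S f" "0 < p"
  shows "continuous_on S (\<lambda>z. cmod (f z) powr p)"
  by (rule continuous_on_powr') (use assms in \<open>auto intro: continuous_on_norm continuous_on_const\<close>)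

lemma Lp_continuous: "continuous_on (sphere 0 1) f \<Longrightarrow> 0 < p \<Longrightarrow> f \<in> Lp p"
  by (simp add: Lp_def integrable_circle_continuous continuous_imp_measurable_circle
      continuous_on_cmod_powr)

lemma Lp_add:
  assumes "f \<in> Lp p" "g \<in> Lp p" "1 \<le> p"
  shows "(\<lambda>z. f z + g z) \<in> Lp p"
proof (rule LpI_bound)
  show "(\<lambda>z. f z + g z) \<in> borel_measurable circle"
    using assms Lp_measurable by measurable
  show "integrable circle (\<lambda>z. 2 powr p * (cmod (f z) powr p + cmod (g z) powr p))"
    using assms by (auto intro!: Lp_integrable)
  show "cmod (f z + g z) powr p \<le> 2 powr p * (cmod (f z) powr p + cmod (g z) powr p)" for z
    using powr_add_le[OF assms(3), of "cmod (f z)" "cmod (g z)"]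
      powr_mono2[of p "cmod (f z + g z)" "cmod (f z) + cmod (g z)"] assms(3) norm_triangle_ineq[of "f z" "g z"]
    by simp
qed

lemma Lp_cmult: "f \<in> Lp p \<Longrightarrow> (\<lambda>z. a * f z) \<in> Lp p"
  by (auto simp: Lp_def norm_mult powr_mult)

lemma Lp_diff: "f \<in> Lp p \<Longrightarrow> g \<in> Lp p \<Longrightarrow> 1 \<le> p \<Longrightarrow> (\<lambda>z. f z - g z) \<in> Lp p"
  using Lp_add[of f p "\<lambda>z. - 1 * g z"] Lp_cmult[of g p "- 1"] by simp

lemma Lp_norm_nonneg [simp]: "0 \<le> Lp_norm p f"
  by (simp add: Lp_norm_def)

lemma Lp_norm_powr: "0 < p \<Longrightarrow> Lp_norm p f powr p = (LINT z|circle. cmod (f z) powr p)"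
  by (simp add: Lp_norm_def powr_powr)

lemma Lp_norm_cmult: "0 < p \<Longrightarrow> Lp_norm p (\<lambda>z. a * f z) = cmod a * Lp_norm p f"
  by (simp add: Lp_norm_def norm_mult powr_mult powr_powr)

lemma Lp_norm_minus_commute: "Lp_norm p (\<lambda>z. f z - g z) = Lp_norm p (\<lambda>z. g z - f z)"
  by (simp add: Lp_norm_def norm_minus_commute)

lemma Lp_norm_cong_AE:
  assumes "f \<in> borel_measurable circle" "g \<in> borel_measurable circle" "AE z in circle. f z = g z"
  shows "Lp_norm p f = Lp_norm p g"
proof -
  have "(LINT z|circle. cmod (f z) powr p) = (LINT z|circle. cmod (g z) powr p)"
    by (rule integral_cong_AE) (use assms in auto)
  then show ?thesis by (simp add: Lp_norm_def)
qed

lemma Lp_norm_le_iff: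
  assumes "0 < p" "0 \<le> c"
  shows "Lp_norm p f \<le> c \<longleftrightarrow> (LINT z|circle. cmod (f z) powr p) \<le> c powr p"
  using assms
  by (metis Lp_norm_nonneg Lp_norm_powr less_imp_le not_le powr_less_mono2 powr_mono2)

lemma Lp_norm_less_imp:
  assumes "0 < p" "Lp_norm p f < c"
  shows "(LINT z|circle. cmod (f z) powr p) \<le> c powr p"
  using assms Lp_norm_le_iff[of p c f] Lp_norm_nonneg[of p f] by linarith

lemma Lp_norm_eq_0_imp_AE:
  assumes "f \<in> Lp p" "0 < p" "Lp_norm p f \<le> 0"
  shows "AE z in circle. f z = 0"
proof -
  have "Lp_norm p f = 0" using assms(3) Lp_norm_nonneg[of p f] by linarith
  then have "(LINT z|circle. cmod (f z) powr p) = 0"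
    using assms(2) by (simp add: Lp_norm_def)
  then have "AE z in circle. cmod (f z) powr p = 0"
    using assms(1) by (subst (asm) integral_nonneg_eq_0_iff_AE) (auto intro: Lp_integrable)
  then show ?thesis by simp
qed

text \<open>Minkowski from convexity of the p-th power. For A and B strictly above the two norms,
  (|f| + |g|) / (A + B) is the convex combination of |f| / A and |g| / B with weights A / (A + B)
  and B / (A + B). Strictness keeps the divisors positive even if a norm vanishes; at the end A and
  B decrease to the norms.\<close>

lemma Lp_norm_triangle:
  assumes f: "f \<in> Lp p" and g: "g \<in> Lp p" and p: "1 \<le> p"
  shows "Lp_norm p (\<lambda>z. f z + g z) \<le> Lp_norm p f + Lp_norm p g"
proof -
  have *: "Lp_norm p (\<lambda>z. f z + g z) \<le> A + B" if A: "Lp_norm p f < A" and B: "Lp_norm p g < B" for A B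
  proof -
    have pos: "0 < A" "0 < B"
      using A B Lp_norm_nonneg[of p f] Lp_norm_nonneg[of p g] by linarith+
    define l where "l = B / (A + B)"
    have l: "0 \<le> l" "l \<le> 1" and l1: "1 - l = A / (A + B)"
      using pos by (auto simp: l_def field_simps)
    let ?h = "\<lambda>z. (A + B) powr p * ((1 - l) * (cmod (f z) powr p / A powr p) + l * (cmod (g z) powr p / B powr p))"
    have le: "cmod (f z + g z) powr p \<le> ?h z" for z
    proof -
      have "cmod (f z + g z) powr p \<le> (cmod (f z) + cmod (g z)) powr p"
        using p by (intro powr_mono2 norm_triangle_ineq) auto
      also have "cmod (f z) + cmod (g z) = (A + B) * ((1 - l) * (cmod (f z) / A) + l * (cmod (g z) / B))"
      proof -
        define S where "S = A + B"
        have "0 < S" using pos by (simp add: S_def)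
        then show ?thesis
          unfolding l1 unfolding l_def S_def[symmetric] using pos by (simp add: field_simps)
      qed
      also have "\<dots> powr p = (A + B) powr p * ((1 - l) * (cmod (f z) / A) + l * (cmod (g z) / B)) powr p"
        by (rule powr_mult)
      also have "\<dots> \<le> (A + B) powr p * ((1 - l) * (cmod (f z) / A) powr p + l * (cmod (g z) / B) powr p)"
        using pos l p by (intro mult_left_mono powr_convex_combination) auto
      also have "\<dots> = ?h z" using pos by (simp add: powr_divide)
      finally show ?thesis .
    qed
    have "(LINT z|circle. cmod (f z + g z) powr p) \<le> (LINT z|circle. ?h z)"
      by (intro integral_mono le) (use Lp_integrable[OF f] Lp_integrable[OF g] Lp_integrable[OF Lp_add[OF f g p]] in auto)
    also have "\<dots> = (A + B) powr p * ((1 - l) * ((LINT z|circle. cmod (f z) powr p) / A powr p)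
          + l * ((LINT z|circle. cmod (g z) powr p) / B powr p))"
      using Lp_integrable[OF f] Lp_integrable[OF g] by simp
    also have "\<dots> \<le> (A + B) powr p * ((1 - l) * 1 + l * 1)"
      using Lp_norm_less_imp[OF _ A] Lp_norm_less_imp[OF _ B] l p pos
      by (intro mult_left_mono add_mono) auto
    finally show ?thesis using p pos by (subst Lp_norm_le_iff) auto
  qed
  show ?thesis
  proof (rule field_le_epsilon)
    fix e :: real assume "0 < e"
    then show "Lp_norm p (\<lambda>z. f z + g z) \<le> Lp_norm p f + Lp_norm p g + e"
      using *[of "Lp_norm p f + e / 2" "Lp_norm p g + e / 2"] by simp
  qed
qed

lemma Lp_norm_triangle_diff:
  assumes "f \<in> Lp p" "g \<in> Lp p" "h \<in> Lp p" "1 \<le> p"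
  shows "Lp_norm p (\<lambda>z. f z - h z) \<le> Lp_norm p (\<lambda>z. f z - g z) + Lp_norm p (\<lambda>z. g z - h z)"
  using Lp_norm_triangle[OF Lp_diff[OF assms(1,2,4)] Lp_diff[OF assms(2,3,4)] assms(4)] by simp

text \<open>Young's inequality is applied to |f| / A and |g| / B, with A and B strictly above the
  norms so that vanishing norms need no separate case. A limit from the right then replaces A and B
  by the norms.\<close>

lemma Lp_Holder:
  assumes f: "f \<in> Lp p" and g: "g \<in> Lp q" and pq: "1 < p" "1 < q" "1 / p + 1 / q = 1"
  shows "cmod (LINT z|circle. f z * g z) \<le> Lp_norm p f * Lp_norm q g"
proof -
  have Young: "cmod (f z * g z) \<le> A * B * (cmod (f z) powr p / A powr p / p + cmod (g z) powr q / B powr q / q)"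
    if "0 < A" "0 < B" for A B z
  proof -
    have "(cmod (f z) / A) * (cmod (g z) / B) \<le> (cmod (f z) / A) powr p / p + (cmod (g z) / B) powr q / q"
      using that pq by (intro Youngs_inequality) auto
    then show ?thesis using that by (simp add: norm_mult powr_divide field_simps)
  qed
  have *: "cmod (LINT z|circle. f z * g z) \<le> A * B" if A: "Lp_norm p f < A" and B: "Lp_norm q g < B" for A B
  proof -
    have pos: "0 < A" "0 < B"
      using A B Lp_norm_nonneg[of p f] Lp_norm_nonneg[of q g] by linarith+
    let ?h = "\<lambda>z. A * B * (cmod (f z) powr p / A powr p / p + cmod (g z) powr q / B powr q / q)"
    have h: "integrable circle ?h"
      using Lp_integrable[OF f] Lp_integrable[OF g] by auto
    have "integrable circle (\<lambda>z. f z * g z)"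
      by (rule Bochner_Integration.integrable_bound[OF h])
        (use Lp_measurable[OF f] Lp_measurable[OF g] Young[OF pos] in
          \<open>auto intro!: AE_I2 order_trans[OF _ abs_ge_self]\<close>)
    then have "cmod (LINT z|circle. f z * g z) \<le> (LINT z|circle. ?h z)"
      by (intro order_trans[OF integral_norm_bound] integral_mono h Young pos) auto
    also have "\<dots> = A * B * ((LINT z|circle. cmod (f z) powr p) / A powr p / p
          + (LINT z|circle. cmod (g z) powr q) / B powr q / q)"
      using Lp_integrable[OF f] Lp_integrable[OF g] by simp
    also have "\<dots> \<le> A * B * (1 / p + 1 / q)"
      using Lp_norm_less_imp[OF _ A] Lp_norm_less_imp[OF _ B] pos pq
      by (intro mult_left_mono add_mono divide_right_mono) auto
    finally show ?thesis using pq by simp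
  qed
  have "((\<lambda>e. (Lp_norm p f + e) * (Lp_norm q g + e)) \<longlongrightarrow> (Lp_norm p f + 0) * (Lp_norm q g + 0)) (at_right 0)"
    by (intro tendsto_intros)
  then show ?thesis
    using * by (intro tendsto_lowerbound[where F = "at_right (0::real)"])
      (auto intro!: eventually_at_rightI[of 0 1])
qed

subsection \<open>The bound on trigonometric polynomials\<close>

lemma trig_poly_superset:
  assumes "finite A" "{n. c n \<noteq> 0} \<subseteq> A"
  shows "trig_poly c z = (\<Sum>n\<in>A. c n * z powi n)"
  unfolding trig_poly_def by (rule sum.mono_neutral_left) (use assms in auto)

lemma trig_poly_add:
  assumes "finite {n. c n \<noteq> 0}" "finite {n. d n \<noteq> 0}"
  shows "trig_poly (\<lambda>n. c n + d n) z = trig_poly c z + trig_poly d z"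
proof -
  let ?A = "{n. c n \<noteq> 0} \<union> {n. d n \<noteq> 0}"
  have "trig_poly c z = (\<Sum>n\<in>?A. c n * z powi n)" "trig_poly d z = (\<Sum>n\<in>?A. d n * z powi n)"
    "trig_poly (\<lambda>n. c n + d n) z = (\<Sum>n\<in>?A. (c n + d n) * z powi n)"
    by (rule trig_poly_superset; use assms in auto)+
  then show ?thesis by (simp add: sum.distrib distrib_right)
qed

lemma finite_support_add:
  "finite {n. c n \<noteq> 0} \<Longrightarrow> finite {n. d n \<noteq> 0} \<Longrightarrow> finite {n. c n + d n \<noteq> (0::complex)}"
  by (rule finite_subset[of _ "{n. c n \<noteq> 0} \<union> {n. d n \<noteq> 0}"]) auto

lemma trig_poly_cmult: "trig_poly (\<lambda>n. a * c n) z = a * trig_poly c z"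
  by (cases "a = 0") (simp_all add: trig_poly_def sum_distrib_left mult.assoc)

lemma finite_support_cmult:
  "finite {n. c n \<noteq> 0} \<Longrightarrow> finite {n. a * c n \<noteq> (0::complex)}"
  by (rule finite_subset[of _ "{n. c n \<noteq> 0}"]) auto

lemma finite_support_riesz: "finite {n. c n \<noteq> 0} \<Longrightarrow> finite {n. riesz_coeffs c n \<noteq> 0}"
  by (rule finite_subset[of _ "{n. c n \<noteq> 0}"]) (auto simp: riesz_coeffs_def)

lemma riesz_coeffs_add: "riesz_coeffs (\<lambda>n. c n + d n) = (\<lambda>n. riesz_coeffs c n + riesz_coeffs d n)"
  by (auto simp: riesz_coeffs_def)

lemma riesz_coeffs_cmult: "riesz_coeffs (\<lambda>n. a * c n) = (\<lambda>n. a * riesz_coeffs c n)"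
  by (auto simp: riesz_coeffs_def)

lemma continuous_on_powi_sphere: "continuous_on (sphere 0 1) (\<lambda>z::complex. z powi n)"
  by (cases "0 \<le> n") (auto simp: power_int_def intro!: continuous_intros)

lemma continuous_on_trig_poly: "continuous_on (sphere 0 1) (trig_poly c)"
  unfolding trig_poly_def by (intro continuous_intros continuous_on_powi_sphere)

lemma powi_minus_sphere: "z \<in> sphere 0 1 \<Longrightarrow> z powi (- n) = cnj (z powi n)" for z :: complex
  using divide_conv_cnj[of z 1] by (simp add: power_int_minus flip: power_int_inverse) 
     (simp add: inverse_eq_divide)

text \<open>On the circle a negative power of z is the conjugate of the opposite positive power, so
  the strictly negative frequencies form the conjugate of a polynomial without constant
  term.\<close>

lemma trig_poly_decomposition:
  assumes "finite {n. c n \<noteq> 0}"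
  obtains U V where "poly V 0 = 0"
    "\<And>z. z \<in> sphere 0 1 \<Longrightarrow> trig_poly (riesz_coeffs c) z = poly U z"
    "\<And>z. z \<in> sphere 0 1 \<Longrightarrow> trig_poly c z = poly U z + cnj (poly V z)"
proof
  define A where "A = {n. c n \<noteq> 0}"
  define P N where "P = {n \<in> A. 0 \<le> n}" and "N = {n \<in> A. n < 0}"
  have fin: "finite A" "finite P" "finite N" using assms by (auto simp: A_def P_def N_def)
  define U where "U = (\<Sum>n\<in>P. monom (c n) (nat n))"
  define V where "V = (\<Sum>n\<in>N. monom (cnj (c n)) (nat (- n)))"
  show "poly V 0 = 0"
    by (auto simp: V_def N_def poly_sum poly_monom intro!: sum.neutral)
  have U: "poly U z = (\<Sum>n\<in>P. c n * z powi n)" for z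
    unfolding U_def poly_sum poly_monom by (rule sum.cong) (auto simp: P_def power_int_def)
  have V: "cnj (poly V z) = (\<Sum>n\<in>N. c n * z powi n)" if "z \<in> sphere 0 1" for z
    unfolding V_def poly_sum poly_monom cnj_sum
  proof (rule sum.cong)
    fix n assume "n \<in> N"
    then have "z ^ nat (- n) = z powi (- n)" by (auto simp: N_def power_int_def)
    then show "cnj (cnj (c n) * z ^ nat (- n)) = c n * z powi n"
      using powi_minus_sphere[OF that, of "- n"] by simp
  qed simp
  show "trig_poly (riesz_coeffs c) z = poly U z" for z
  proof -
    have *: "{n. riesz_coeffs c n \<noteq> 0} \<subseteq> P" by (auto simp: P_def A_def riesz_coeffs_def)
    show ?thesis
      unfolding trig_poly_superset[OF fin(2) *] U
      by (intro sum.cong) (auto simp: riesz_coeffs_def P_def)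
  qed
  show "trig_poly c z = poly U z + cnj (poly V z)" if "z \<in> sphere 0 1" for z
    unfolding U V[OF that] trig_poly_superset[of A c, OF fin(1) eq_refl[OF A_def[symmetric]]]
    by (subst sum.union_disjoint[symmetric]) (use fin in \<open>auto simp: P_def N_def intro!: sum.cong\<close>)
qed

section \<open>From regularised energies to \<open>L\<^sup>p\<close> norms\<close>

text \<open>After division by x + y this is \<open>t \<le> t powr b\<close> on the unit interval,
  applied to two numbers with sum 1. It separates the regularising \<epsilon> from |f|^2.\<close>

lemma powr_subadditive:
  fixes x y b :: real
  assumes "0 \<le> b" "b \<le> 1" "0 \<le> x" "0 \<le> y"
  shows "(x + y) powr b \<le> x powr b + y powr b"
proof (cases "x + y = 0")
  case True then show ?thesis using assms by simp
next
  case False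
  then have s: "0 < x + y" using assms by simp
  have le: "t \<le> t powr b" if "0 \<le> t" "t \<le> 1" for t :: real
    using powr_mono'[of b 1 t] that assms by (cases "t = 0") auto
  have "1 = x / (x + y) + y / (x + y)" using s by (simp flip: add_divide_distrib)
  also have "\<dots> \<le> (x / (x + y)) powr b + (y / (x + y)) powr b"
    using s assms by (intro add_mono le) auto
  also have "\<dots> = (x powr b + y powr b) / (x + y) powr b"
    using s assms by (simp add: powr_divide add_divide_distrib)
  finally show ?thesis using s by (simp add: field_simps)
qed

lemma integral_riesz_powr_le:
  fixes p :: real
  assumes c: "finite {n. c n \<noteq> 0}" and p: "1 < p" "p \<le> 2"
  shows "(LINT z|circle. cmod (trig_poly (riesz_coeffs c) z) powr p)
     \<le> 1 / (p - 1) * (LINT z|circle. cmod (trig_poly c z) powr p)"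
proof -
  obtain U V where V0: "poly V 0 = 0"
    and U: "\<And>z. z \<in> sphere 0 1 \<Longrightarrow> trig_poly (riesz_coeffs c) z = poly U z"
    and UV: "\<And>z. z \<in> sphere 0 1 \<Longrightarrow> trig_poly c z = poly U z + cnj (poly V z)"
    using trig_poly_decomposition[OF c] by metis
  define C where "C = 1 / (p - 1)"
  have C: "0 < C" using p by (simp add: C_def)
  let ?I = "integral {0..2 * pi}"
  let ?u = "\<lambda>\<theta>. cmod (trig_poly (riesz_coeffs c) (cis \<theta>)) powr p"
  let ?f = "\<lambda>\<theta>. cmod (trig_poly c (cis \<theta>)) powr p"
  have cont: "continuous_on {0..2 * pi} (\<lambda>\<theta>. h (cis \<theta>))" if "continuous_on (sphere 0 1) h"
    for h :: "complex \<Rightarrow> real"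
    by (rule continuous_on_compose2[OF that]) (auto intro!: continuous_intros)
  have cont_u: "continuous_on {0..2 * pi} ?u" and cont_f: "continuous_on {0..2 * pi} ?f"
    using p by (auto intro!: cont continuous_on_cmod_powr continuous_on_trig_poly)
  have eps: "?I ?u \<le> C * ?I ?f + C * (2 * pi) * \<delta>" if \<delta>: "0 < \<delta>" for \<delta>
  proof -
    \<comment> \<open>Chosen so that \<open>\<epsilon> powr (p / 2)\<close>, the excess left by
      subadditivity on the right-hand side, is exactly \<delta>. On the left-hand side \<epsilon>
      and |v|^2 are dropped by monotonicity.\<close>
    define \<epsilon> where "\<epsilon> = \<delta> powr (2 / p)"
    have \<epsilon>: "0 < \<epsilon>" using \<delta> by (simp add: \<epsilon>_def)
    have \<epsilon>p: "\<epsilon> powr (p / 2) = \<delta>" using \<delta> p by (simp add: \<epsilon>_def powr_powr)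
    have sq: "(x\<^sup>2) powr (p / 2) = x powr p" if "0 \<le> x" for x :: real
      using that by (simp add: powr_powr flip: powr_numeral)
    have cont_e: "continuous_on {0..2 * pi} (\<lambda>\<theta>. energy \<epsilon> (p / 2) (poly U (cis \<theta>), poly V (cis \<theta>)))"
      "continuous_on {0..2 * pi} (\<lambda>\<theta>. energy \<epsilon> (p / 2) (poly U (cis \<theta>) + cnj (poly V (cis \<theta>))))"
      by (intro continuous_intros \<epsilon>)+
    have "?I ?u \<le> ?I (\<lambda>\<theta>. energy \<epsilon> (p / 2) (poly U (cis \<theta>), poly V (cis \<theta>)))"
    proof (intro integral_le integrable_continuous_real cont_u cont_e)
      fix \<theta> 
      have "?u \<theta> = ((cmod (poly U (cis \<theta>)))\<^sup>2) powr (p / 2)" by (simp add: U sq)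
      also have "\<dots> \<le> energy \<epsilon> (p / 2) (poly U (cis \<theta>), poly V (cis \<theta>))"
        unfolding energy_def using p \<epsilon> by (intro powr_mono2) (auto simp: power2_norm_eq_inner)
      finally show "?u \<theta> \<le> energy \<epsilon> (p / 2) (poly U (cis \<theta>), poly V (cis \<theta>))" .
    qed
    also have "\<dots> \<le> C * ?I (\<lambda>\<theta>. energy \<epsilon> (p / 2) (poly U (cis \<theta>) + cnj (poly V (cis \<theta>))))"
      using integral_energy_le[OF V0 _ _ \<epsilon>, of "p / 2"] p by (simp add: C_def)
    also have "?I (\<lambda>\<theta>. energy \<epsilon> (p / 2) (poly U (cis \<theta>) + cnj (poly V (cis \<theta>)))) \<le> ?I (\<lambda>\<theta>. ?f \<theta> + \<delta>)"
    proof (intro integral_le integrable_continuous_real cont_e)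
      show "continuous_on {0..2 * pi} (\<lambda>\<theta>. ?f \<theta> + \<delta>)" by (intro continuous_intros cont_f)
      fix \<theta>
      have "energy \<epsilon> (p / 2) (poly U (cis \<theta>) + cnj (poly V (cis \<theta>)))
          = (\<epsilon> + (cmod (trig_poly c (cis \<theta>)))\<^sup>2) powr (p / 2)"
        by (simp add: energy_def UV power2_norm_eq_inner)
      also have "\<dots> \<le> \<epsilon> powr (p / 2) + ((cmod (trig_poly c (cis \<theta>)))\<^sup>2) powr (p / 2)"
        using p \<epsilon> by (intro powr_subadditive) auto
      also have "\<dots> = ?f \<theta> + \<delta>" by (simp add: \<epsilon>p sq)
      finally show "energy \<epsilon> (p / 2) (poly U (cis \<theta>) + cnj (poly V (cis \<theta>))) \<le> ?f \<theta> + \<delta>" .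
    qed
    also have "?I (\<lambda>\<theta>. ?f \<theta> + \<delta>) = ?I ?f + 2 * pi * \<delta>"
      using integrable_continuous_real[OF cont_f] by (subst integral_add) auto
    finally show ?thesis using C by (simp add: algebra_simps)
  qed
  have "?I ?u \<le> C * ?I ?f + e" if "0 < e" for e
    using eps[of "e / (C * (2 * pi))"] that C by simp
  then have "?I ?u \<le> C * ?I ?f" by (rule field_le_epsilon)
  then have "1 / (2 * pi) * ?I ?u \<le> 1 / (2 * pi) * (C * ?I ?f)"
    by (intro mult_left_mono) auto
  moreover have "(LINT z|circle. cmod (trig_poly (riesz_coeffs c) z) powr p) = 1 / (2 * pi) * ?I ?u"
    "(LINT z|circle. cmod (trig_poly c z) powr p) = 1 / (2 * pi) * ?I ?f"
    using p by (subst integral_circle_continuous; simp add: continuous_on_cmod_powr continuous_on_trig_poly)+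
  ultimately show ?thesis
    unfolding C_def by (simp only: mult.left_commute[of "1 / (2 * pi)"])
qed

lemma trig_poly_in_Lp: "0 < p \<Longrightarrow> trig_poly c \<in> Lp p"
  by (rule Lp_continuous[OF continuous_on_trig_poly])

lemma riesz_norm_le_small_exponent:
  assumes c: "finite {n. c n \<noteq> 0}" and p: "1 < p" "p \<le> 2"
  shows "Lp_norm p (trig_poly (riesz_coeffs c)) \<le> p / (p - 1) * Lp_norm p (trig_poly c)"
proof -
  have "1 / (p - 1) \<le> p / (p - 1)" using p by (simp add: divide_right_mono)
  also have "\<dots> = (p / (p - 1)) powr 1" using p by simp
  also have "\<dots> \<le> (p / (p - 1)) powr p" using p by (intro powr_mono) (auto simp: field_simps)
  finally have "1 / (p - 1) * (LINT z|circle. cmod (trig_poly c z) powr p)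
      \<le> (p / (p - 1)) powr p * (LINT z|circle. cmod (trig_poly c z) powr p)"
    by (intro mult_right_mono) auto
  also have "\<dots> = (p / (p - 1) * Lp_norm p (trig_poly c)) powr p"
    using p by (subst powr_mult) (simp add: Lp_norm_powr)
  finally show ?thesis
    using integral_riesz_powr_le[OF assms] p
    by (subst Lp_norm_le_iff) (auto intro: order_trans mult_nonneg_nonneg)
qed

section \<open>The algebra of trigonometric polynomials and its uniform density\<close>

text \<open>Agreement is demanded on the circle only, where cnj z = \<open>z powi (- 1)\<close>.
  Thus real polynomials in Re z and Im z qualify, which is what Stone-Weierstrass supplies.\<close>

definition is_trig_poly :: "(complex \<Rightarrow> complex) \<Rightarrow> bool" where
  "is_trig_poly f \<longleftrightarrow> (\<exists>c. finite {n. c n \<noteq> 0} \<and> (\<forall>z\<in>sphere 0 1. f z = trig_poly c z))"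

lemma is_trig_poly_cong:
  "is_trig_poly f \<Longrightarrow> (\<And>z. z \<in> sphere 0 1 \<Longrightarrow> g z = f z) \<Longrightarrow> is_trig_poly g"
  by (auto simp: is_trig_poly_def)

lemma is_trig_polyE:
  assumes "is_trig_poly f"
  obtains c where "finite {n. c n \<noteq> 0}" "\<And>z. z \<in> sphere 0 1 \<Longrightarrow> f z = trig_poly c z"
  using assms unfolding is_trig_poly_def by blast

lemma is_trig_poly_add:
  assumes "is_trig_poly f" "is_trig_poly g"
  shows "is_trig_poly (\<lambda>z. f z + g z)"
proof -
  from assms(1) obtain c
    where c: "finite {n. c n \<noteq> 0}" "\<And>z. z \<in> sphere 0 1 \<Longrightarrow> f z = trig_poly c z"
    by (rule is_trig_polyE) blast
  from assms(2) obtain d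
    where d: "finite {n. d n \<noteq> 0}" "\<And>z. z \<in> sphere 0 1 \<Longrightarrow> g z = trig_poly d z"
    by (rule is_trig_polyE) blast
  show ?thesis
    unfolding is_trig_poly_def
    using c d by (intro exI[of _ "\<lambda>n. c n + d n"]) (simp add: finite_support_add trig_poly_add)
qed

lemma is_trig_poly_cmult:
  assumes "is_trig_poly f"
  shows "is_trig_poly (\<lambda>z. a * f z)"
proof -
  from assms obtain c
    where c: "finite {n. c n \<noteq> 0}" "\<And>z. z \<in> sphere 0 1 \<Longrightarrow> f z = trig_poly c z"
    by (rule is_trig_polyE) blast
  show ?thesis
    unfolding is_trig_poly_def
    using c finite_support_cmult[of c a] by (intro exI[of _ "\<lambda>n. a * c n"]) (simp add: trig_poly_cmult)
qed

lemma is_trig_poly_powi: "is_trig_poly (\<lambda>z. z powi n)"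
proof -
  define c where "c m = (if m = n then 1 else 0 :: complex)" for m
  have "{m. c m \<noteq> 0} = {n}" by (auto simp: c_def)
  then show ?thesis
    unfolding is_trig_poly_def trig_poly_def by (intro exI[of _ c]) (simp add: c_def)
qed

lemma is_trig_poly_const: "is_trig_poly (\<lambda>z. a)"
  using is_trig_poly_cmult[OF is_trig_poly_powi[of 0], of a] by simp

lemma is_trig_poly_sum:
  "finite A \<Longrightarrow> (\<And>i. i \<in> A \<Longrightarrow> is_trig_poly (f i)) \<Longrightarrow> is_trig_poly (\<lambda>z. \<Sum>i\<in>A. f i z)"
  by (induction A rule: finite_induct) (auto intro: is_trig_poly_const is_trig_poly_add)

lemma is_trig_poly_mult:
  assumes "is_trig_poly f" "is_trig_poly g"
  shows "is_trig_poly (\<lambda>z. f z * g z)"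
proof -
  from assms(1) obtain c
    where c: "finite {n. c n \<noteq> 0}" "\<And>z. z \<in> sphere 0 1 \<Longrightarrow> f z = trig_poly c z"
    by (rule is_trig_polyE) blast
  from assms(2) obtain d
    where d: "finite {n. d n \<noteq> 0}" "\<And>z. z \<in> sphere 0 1 \<Longrightarrow> g z = trig_poly d z"
    by (rule is_trig_polyE) blast
  have "is_trig_poly (\<lambda>z. \<Sum>n | c n \<noteq> 0. \<Sum>m | d m \<noteq> 0. c n * d m * z powi (n + m))"
    by (intro is_trig_poly_sum c d is_trig_poly_cmult is_trig_poly_powi)
  then show ?thesis
  proof (rule is_trig_poly_cong)
    fix z :: complex assume z: "z \<in> sphere 0 1"
    then have "z \<noteq> 0" by auto
    then show "f z * g z = (\<Sum>n | c n \<noteq> 0. \<Sum>m | d m \<noteq> 0. c n * d m * z powi (n + m))"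
      by (simp add: c(2)[OF z] d(2)[OF z] trig_poly_def sum_product power_int_add mult_ac)
  qed
qed

lemma is_trig_poly_real_polynomial_function:
  "real_polynomial_function g \<Longrightarrow> is_trig_poly (\<lambda>z::complex. of_real (g z))"
proof (induction g rule: real_polynomial_function.induct)
  case (linear g)
  interpret bounded_linear g by fact
  \<comment> \<open>The coefficients come from g z = Re z * g 1 + Im z * g \<i> with Re z = (z +
    1/z) / 2 and Im z = (z - 1/z) / (2 \<i>) on the circle.\<close>
  have "is_trig_poly (\<lambda>z. (g 1 - \<i> * g \<i>) / 2 * z powi 1 + (g 1 + \<i> * g \<i>) / 2 * z powi (- 1))"
    by (intro is_trig_poly_add is_trig_poly_cmult is_trig_poly_powi)
  then show ?case
  proof (rule is_trig_poly_cong)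
    fix z :: complex assume z: "z \<in> sphere 0 1"
    have "g z = g (Re z *\<^sub>R 1 + Im z *\<^sub>R \<i>)"
      by (rule arg_cong[of _ _ g]) (simp add: complex_eq_iff)
    then have "g z = Re z * g 1 + Im z * g \<i>" by (simp only: add scaleR real_scaleR_def)
    moreover have "z powi (- 1) = cnj z" using powi_minus_sphere[OF z, of 1] by simp
    ultimately show "of_real (g z) = (g 1 - \<i> * g \<i>) / 2 * z powi 1 + (g 1 + \<i> * g \<i>) / 2 * z powi (- 1)"
      by (simp add: complex_eq_iff algebra_simps add_divide_distrib[symmetric])
  qed
qed (auto intro: is_trig_poly_const is_trig_poly_add is_trig_poly_mult)

lemma trig_poly_uniformly_dense:
  fixes f :: "complex \<Rightarrow> complex"
  assumes "continuous_on (sphere 0 1) f" "0 < e"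
  obtains c where "finite {n. c n \<noteq> 0}" "\<And>z. z \<in> sphere 0 1 \<Longrightarrow> cmod (f z - trig_poly c z) < e"
proof -
  obtain g where g: "polynomial_function g" "\<forall>z\<in>sphere 0 1. cmod (f z - g z) < e"
    using Stone_Weierstrass_polynomial_function[OF compact_sphere assms] by blast
  have "real_polynomial_function (\<lambda>z. Re (g z))" "real_polynomial_function (\<lambda>z. Im (g z))"
    using g(1) bounded_linear_Re bounded_linear_Im unfolding polynomial_function_def o_def by blast+
  then have "is_trig_poly (\<lambda>z. of_real (Re (g z)) + \<i> * of_real (Im (g z)))"
    by (intro is_trig_poly_add is_trig_poly_cmult is_trig_poly_real_polynomial_function)
  then have "is_trig_poly g" by (simp flip: complex_eq)
  then obtain c where "finite {n. c n \<noteq> 0}" "\<And>z. z \<in> sphere 0 1 \<Longrightarrow> g z = trig_poly c z"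
    by (rule is_trig_polyE) blast
  with g(2) show thesis by (intro that[of c]) auto
qed

section \<open>Orthogonality and duality\<close>

lemma integral_circle_powi:
  "(LINT z|circle. z powi n) = (if n = 0 then 1 else 0)"
proof (cases "n = 0")
  case False
  have "((\<lambda>\<theta>. cis (of_int n * \<theta>)) has_integral
      cis (of_int n * (2 * pi)) / (\<i> * of_int n) - cis (of_int n * 0) / (\<i> * of_int n)) {0..2 * pi}"
  proof (rule fundamental_theorem_of_calculus)
    fix \<theta> :: real
    show "((\<lambda>\<theta>. cis (of_int n * \<theta>) / (\<i> * of_int n)) has_vector_derivative cis (of_int n * \<theta>))
        (at \<theta> within {0..2 * pi})"
      using False unfolding cis_conv_exp
      by (auto intro!: derivative_eq_intros has_vector_derivative_real_field simp: field_simps)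
  qed simp
  moreover have "cis (of_int n * (2 * pi)) = 1"
    using cis_multiple_2pi[of "of_int n"] by (simp add: mult_ac)
  ultimately have "integral {0..2 * pi} (\<lambda>\<theta>. cis \<theta> powi n) = 0"
    by (auto simp: cis_power_int dest!: integral_unique)
  then show ?thesis
    using False by (simp add: integral_circle_continuous continuous_on_powi_sphere)
qed simp

text \<open>Orthonormality of the powers of z. A free common superset A of the supports lets
  \<open>riesz_self_adjoint\<close> sum over one set for both sequences and their
  truncations.\<close>

lemma integral_trig_poly_cnj:
  assumes A: "finite A" "{n. c n \<noteq> 0} \<subseteq> A" "{n. d n \<noteq> 0} \<subseteq> A"
  shows "(LINT z|circle. trig_poly c z * cnj (trig_poly d z)) = (\<Sum>n\<in>A. c n * cnj (d n))"
proof -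
  have int: "integrable circle (\<lambda>z. a * z powi k)" for a and k :: int
    by (intro integrable_circle_continuous continuous_intros continuous_on_powi_sphere)
  have "(LINT z|circle. trig_poly c z * cnj (trig_poly d z))
      = (LINT z|circle. (\<Sum>n\<in>A. \<Sum>m\<in>A. c n * cnj (d m) * z powi (n - m)))"
  proof (rule Bochner_Integration.integral_cong[OF refl])
    fix z assume "z \<in> space circle"
    then have z: "z \<in> sphere 0 1" by (simp add: space_circle)
    then have "z \<noteq> 0" by auto
    then have "z powi (n - m) = z powi n * cnj (z powi m)" for n m
      using power_int_add[of z n "- m"] powi_minus_sphere[OF z, of m] by simp
    then show "trig_poly c z * cnj (trig_poly d z) = (\<Sum>n\<in>A. \<Sum>m\<in>A. c n * cnj (d m) * z powi (n - m))"
      by (simp add: trig_poly_superset[OF A(1,2)] trig_poly_superset[OF A(1,3)] cnj_sum sum_product mult_ac)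
  qed
  also have "\<dots> = (\<Sum>n\<in>A. \<Sum>m\<in>A. c n * cnj (d m) * (if n - m = 0 then 1 else 0))"
    unfolding integral_circle_powi[symmetric]
    by (subst Bochner_Integration.integral_sum, intro Bochner_Integration.integrable_sum int)
       (intro sum.cong refl, subst Bochner_Integration.integral_sum, intro int, simp)
  also have "\<dots> = (\<Sum>n\<in>A. c n * cnj (d n))"
    using A(1) by (intro sum.cong) (auto simp: if_distrib cong: if_cong)
  finally show ?thesis .
qed

lemma riesz_self_adjoint:
  assumes "finite {n. c n \<noteq> 0}" "finite {n. d n \<noteq> 0}"
  shows "(LINT z|circle. trig_poly (riesz_coeffs c) z * cnj (trig_poly d z))
       = (LINT z|circle. trig_poly c z * cnj (trig_poly (riesz_coeffs d) z))"
proof -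
  let ?A = "{n. c n \<noteq> 0} \<union> {n. d n \<noteq> 0}"
  have "finite ?A" "{n. c n \<noteq> 0} \<subseteq> ?A" "{n. d n \<noteq> 0} \<subseteq> ?A"
    "{n. riesz_coeffs c n \<noteq> 0} \<subseteq> ?A" "{n. riesz_coeffs d n \<noteq> 0} \<subseteq> ?A"
    using assms by (auto simp: riesz_coeffs_def)
  then show ?thesis
    by (simp add: integral_trig_poly_cnj[of ?A]) (auto intro!: sum.cong simp: riesz_coeffs_def)
qed

lemma Lp_norm_le_sup:
  assumes "0 < p" "f \<in> Lp p" "0 \<le> B" "\<And>z. z \<in> sphere 0 1 \<Longrightarrow> cmod (f z) \<le> B"
  shows "Lp_norm p f \<le> B"
proof -
  have "(LINT z|circle. cmod (f z) powr p) \<le> (LINT z|circle. B powr p)"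
    by (intro integral_mono Lp_integrable assms)
       (use assms in \<open>auto simp: space_circle intro!: powr_mono2\<close>)
  then show ?thesis using assms by (simp add: Lp_norm_le_iff)
qed

lemma Lp_cnj: "f \<in> Lp p \<Longrightarrow> (\<lambda>z. cnj (f z)) \<in> Lp p"
  using borel_measurable_continuous_onI[of cnj] by (auto simp: Lp_def intro: continuous_intros)

lemma Lp_norm_cnj: "Lp_norm p (\<lambda>z. cnj (f z)) = Lp_norm p f"
  by (simp add: Lp_norm_def)

text \<open>The projection h is tested against the extremal function of Hoelder's inequality, g =
  |h|^(p-2) h, for which the pairing is H^p and the q-norm is H^(p-1). Self-adjointness moves the
  projection to the other factor, where the bound K for the exponent q applies, and H^p \<le> K F
  H^(p-1) results. As g is in general not a trigonometric polynomial, it is first replaced by a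
  uniform approximation.\<close>

lemma riesz_norm_le_dual:
  assumes c: "finite {n. c n \<noteq> 0}" and p: "2 < p" and pq: "1 / p + 1 / q = 1"
    and K: "\<And>d. finite {n. d n \<noteq> 0} \<Longrightarrow>
       Lp_norm q (trig_poly (riesz_coeffs d)) \<le> K * Lp_norm q (trig_poly d)" "0 \<le> K"
  shows "Lp_norm p (trig_poly (riesz_coeffs c)) \<le> K * Lp_norm p (trig_poly c)"
proof -
  have q_eq: "q = p / (p - 1)" using pq p by (cases "q = 0") (auto simp: field_simps)
  have q: "1 < q" using p by (simp add: q_eq)
  define h where "h = trig_poly (riesz_coeffs c)"
  \<comment> \<open>Here p > 2 matters: the exponent p - 2 is positive, so g is continuous also at
    the zeros of h and can be approximated uniformly.\<close>
  define g where "g z = of_real (cmod (h z) powr (p - 2)) * h z" for z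
  have h: "h \<in> Lp p" "continuous_on (sphere 0 1) h"
    using p by (simp_all add: h_def trig_poly_in_Lp continuous_on_trig_poly)
  have g_cont: "continuous_on (sphere 0 1) g"
    unfolding g_def using p by (intro continuous_intros continuous_on_cmod_powr h) auto
  have g: "g \<in> Lp q" using g_cont q by (simp add: Lp_continuous)
  have cmod_g: "cmod (g z) = cmod (h z) powr (p - 1)" for z
  proof -
    have "cmod (g z) = cmod (h z) powr (p - 2) * cmod (h z)" by (simp add: g_def norm_mult)
    also have "\<dots> = cmod (h z) powr (p - 1)"
      using p by (cases "h z = 0") (auto simp: powr_diff power2_eq_square)
    finally show ?thesis .
  qed
  define H F where "H = Lp_norm p h" and "F = Lp_norm p (trig_poly c)"
  have HF: "0 \<le> H" "0 \<le> F" by (simp_all add: H_def F_def)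
  have "Lp_norm q g = H powr (p - 1)"
    using p q by (simp add: H_def Lp_norm_def cmod_g powr_powr q_eq)
  moreover have hg: "(LINT z|circle. h z * cnj (g z)) = of_real (H powr p)"
  proof -
    have "h z * cnj (g z) = of_real (cmod (h z) powr p)" for z
    proof -
      have "h z * cnj (g z) = of_real (cmod (h z) powr (p - 2) * (cmod (h z))\<^sup>2)"
        using complex_norm_square[of "h z"] by (simp add: g_def)
      also have "cmod (h z) powr (p - 2) * (cmod (h z))\<^sup>2 = cmod (h z) powr p"
        using p by (cases "h z = 0") (auto simp: powr_diff)
      finally show ?thesis .
    qed
    then show ?thesis using p by (simp add: H_def Lp_norm_powr)
  qed
  \<comment> \<open>Replacing g by a polynomial d within \<delta> costs K * F * \<delta> through the
    q-norm of d, and H * \<delta> through the pairing of h with g - d.\<close>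
  ultimately have key: "H powr p \<le> K * F * H powr (p - 1) + (K * F + H) * \<delta>" if "0 < \<delta>" for \<delta>
  proof -
    obtain d where d: "finite {n. d n \<noteq> 0}"
      and gd: "\<And>z. z \<in> sphere 0 1 \<Longrightarrow> cmod (g z - trig_poly d z) < \<delta>"
      using trig_poly_uniformly_dense[OF g_cont \<open>0 < \<delta>\<close>] by metis
    have dq: "trig_poly d \<in> Lp q" using q by (simp add: trig_poly_in_Lp)
    have diff: "(\<lambda>z. g z - trig_poly d z) \<in> Lp q" "(\<lambda>z. trig_poly d z - g z) \<in> Lp q"
      using q by (auto intro: Lp_diff g dq)
    have small: "Lp_norm q (\<lambda>z. g z - trig_poly d z) \<le> \<delta>"
      using gd q that by (intro Lp_norm_le_sup diff) (auto intro: less_imp_le)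
    have nd: "Lp_norm q (trig_poly d) \<le> H powr (p - 1) + \<delta>"
      using Lp_norm_triangle[OF g diff(2)] small q \<open>Lp_norm q g = H powr (p - 1)\<close>
      by (simp add: Lp_norm_minus_commute[of q g])
    have int: "integrable circle (\<lambda>z. h z * cnj (trig_poly d z))"
        "integrable circle (\<lambda>z. h z * cnj (g z - trig_poly d z))"
      by (intro integrable_circle_continuous continuous_intros h g_cont continuous_on_trig_poly)+
    have "of_real (H powr p) = (LINT z|circle. h z * cnj (trig_poly d z))
        + (LINT z|circle. h z * cnj (g z - trig_poly d z))"
      unfolding hg[symmetric]
      by (subst Bochner_Integration.integral_add[OF int, symmetric]) (simp add: algebra_simps)
    also have "(LINT z|circle. h z * cnj (trig_poly d z))
        = (LINT z|circle. trig_poly c z * cnj (trig_poly (riesz_coeffs d) z))"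
      unfolding h_def by (rule riesz_self_adjoint[OF c d])
    finally have "cmod (of_real (H powr p)) \<le>
        cmod (LINT z|circle. trig_poly c z * cnj (trig_poly (riesz_coeffs d) z))
        + cmod (LINT z|circle. h z * cnj (g z - trig_poly d z))"
      by (metis norm_triangle_ineq)
    also have "cmod (LINT z|circle. trig_poly c z * cnj (trig_poly (riesz_coeffs d) z))
        \<le> F * Lp_norm q (trig_poly (riesz_coeffs d))"
      unfolding F_def using p q pq
      by (subst Lp_norm_cnj[symmetric], intro Lp_Holder Lp_cnj trig_poly_in_Lp) auto
    also have "cmod (LINT z|circle. h z * cnj (g z - trig_poly d z)) \<le> H * Lp_norm q (\<lambda>z. g z - trig_poly d z)"
      unfolding H_def using p q pq
      by (subst Lp_norm_cnj[symmetric], intro Lp_Holder Lp_cnj diff h) auto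
    finally have "H powr p \<le> F * Lp_norm q (trig_poly (riesz_coeffs d)) + H * Lp_norm q (\<lambda>z. g z - trig_poly d z)"
      by simp
    also have "\<dots> \<le> F * (K * (H powr (p - 1) + \<delta>)) + H * \<delta>"
      by (intro add_mono mult_left_mono small HF order_trans[OF K(1)[OF d]] nd K(2))
    finally show ?thesis by (simp add: algebra_simps)
  qed
  have "H powr p \<le> K * F * H powr (p - 1) + e" if "0 < e" for e
  proof -
    let ?\<delta> = "e / (K * F + H + 1)"
    have s: "0 < K * F + H + 1" using HF K(2) by (simp add: add_nonneg_pos)
    then have "H powr p \<le> K * F * H powr (p - 1) + (K * F + H) * ?\<delta>"
      using that by (intro key) simp
    also have "(K * F + H) * ?\<delta> \<le> e"
      using s that by (simp add: field_simps)
    finally show ?thesis by simp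
  qed
  then have le: "H powr p \<le> K * F * H powr (p - 1)" by (rule field_le_epsilon)
  show ?thesis
  proof (cases "H = 0")
    case True
    then show ?thesis using HF K(2) by (simp add: H_def h_def F_def)
  next
    case False
    then have "H * H powr (p - 1) \<le> (K * F) * H powr (p - 1)"
      using le HF by (simp add: powr_diff)
    then show ?thesis
      using False HF by (simp add: H_def h_def F_def)
  qed
qed

theorem riesz_norm_le:
  assumes c: "finite {n. c n \<noteq> 0}" and p: "1 < p" and pq: "1 / p + 1 / q = 1"
  shows "Lp_norm p (trig_poly (riesz_coeffs c)) \<le> max p q * Lp_norm p (trig_poly c)"
proof (cases "p \<le> 2")
  case True
  have "q = p / (p - 1)" using pq p by (cases "q = 0") (auto simp: field_simps)
  then have "Lp_norm p (trig_poly (riesz_coeffs c)) \<le> q * Lp_norm p (trig_poly c)"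
    using riesz_norm_le_small_exponent[OF c p True] by simp
  also have "\<dots> \<le> max p q * Lp_norm p (trig_poly c)"
    by (intro mult_right_mono) auto
  finally show ?thesis .
next
  case False
  have q: "q = p / (p - 1)" using pq p by (cases "q = 0") (auto simp: field_simps)
  have "1 < q" "q \<le> 2" using False by (auto simp: q field_simps)
  \<comment> \<open>The constant obtained for the small exponent q is q / (q - 1), which is p;
    duality transfers it unchanged.\<close>
  moreover have "p = q / (q - 1)" using p by (simp add: q field_simps)
  ultimately have "Lp_norm p (trig_poly (riesz_coeffs c)) \<le> p * Lp_norm p (trig_poly c)"
    using riesz_norm_le_dual[OF c _ pq, of p] riesz_norm_le_small_exponent[of _ q] False by simp
  also have "\<dots> \<le> max p q * Lp_norm p (trig_poly c)"
    by (intro mult_right_mono) auto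
  finally show ?thesis .
qed

subsection \<open>Density of trigonometric polynomials\<close>

text \<open>The closure of the trigonometric polynomials in \<open>Lp p\<close>. It is shown to
  contain continuous functions, indicators of compact and then of Borel sets, simple functions, and
  finally all of \<open>Lp p\<close>.\<close>

definition trig_approx :: "real \<Rightarrow> (complex \<Rightarrow> complex) \<Rightarrow> bool" where
  "trig_approx p f \<longleftrightarrow> f \<in> Lp p \<and>
     (\<forall>e>0. \<exists>c. finite {n. c n \<noteq> 0} \<and> Lp_norm p (\<lambda>z. f z - trig_poly c z) < e)"

lemma trig_approx_closed:
  assumes "1 \<le> p" and f: "f \<in> Lp p"
    and approx: "\<And>e. 0 < e \<Longrightarrow> \<exists>g. trig_approx p g \<and> Lp_norm p (\<lambda>z. f z - g z) < e"
  shows "trig_approx p f"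
  unfolding trig_approx_def
proof (intro conjI f allI impI)
  fix e :: real assume "0 < e"
  then obtain g where g: "trig_approx p g" "Lp_norm p (\<lambda>z. f z - g z) < e / 2"
    using approx[of "e / 2"] by auto
  then obtain c where c: "finite {n. c n \<noteq> 0}" "Lp_norm p (\<lambda>z. g z - trig_poly c z) < e / 2"
    using \<open>0 < e\<close> unfolding trig_approx_def by (meson half_gt_zero)
  have "Lp_norm p (\<lambda>z. f z - trig_poly c z) < e"
    using Lp_norm_triangle_diff[OF f _ trig_poly_in_Lp, of g c] g c assms(1)
    by (simp add: trig_approx_def)
  with c show "\<exists>c. finite {n. c n \<noteq> 0} \<and> Lp_norm p (\<lambda>z. f z - trig_poly c z) < e" by blast
qed

lemma trig_approx_add:
  assumes "1 \<le> p" "trig_approx p f" "trig_approx p g"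
  shows "trig_approx p (\<lambda>z. f z + g z)"
  unfolding trig_approx_def
proof (intro conjI allI impI)
  have fg: "f \<in> Lp p" "g \<in> Lp p" using assms by (auto simp: trig_approx_def)
  then show "(\<lambda>z. f z + g z) \<in> Lp p" using assms by (auto intro: Lp_add)
  fix e :: real assume "0 < e"
  then obtain c d where c: "finite {n. c n \<noteq> 0}" "Lp_norm p (\<lambda>z. f z - trig_poly c z) < e / 2"
    and d: "finite {n. d n \<noteq> 0}" "Lp_norm p (\<lambda>z. g z - trig_poly d z) < e / 2"
    using assms unfolding trig_approx_def by (meson half_gt_zero)
  have "Lp_norm p (\<lambda>z. (f z - trig_poly c z) + (g z - trig_poly d z)) < e"
    using Lp_norm_triangle[of "\<lambda>z. f z - trig_poly c z" p "\<lambda>z. g z - trig_poly d z"] c d fg assms(1)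
    by (simp add: Lp_diff trig_poly_in_Lp)
  then have "Lp_norm p (\<lambda>z. f z + g z - trig_poly (\<lambda>n. c n + d n) z) < e"
    using c d by (simp add: trig_poly_add algebra_simps)
  then show "\<exists>c. finite {n. c n \<noteq> 0} \<and> Lp_norm p (\<lambda>z. f z + g z - trig_poly c z) < e"
    using finite_support_add[OF c(1) d(1)] by (intro exI conjI)
qed

lemma trig_approx_cmult:
  assumes "1 \<le> p" "trig_approx p f"
  shows "trig_approx p (\<lambda>z. a * f z)"
  unfolding trig_approx_def
proof (intro conjI allI impI)
  have f: "f \<in> Lp p" using assms by (auto simp: trig_approx_def)
  then show "(\<lambda>z. a * f z) \<in> Lp p" by (rule Lp_cmult)
  fix e :: real assume e: "0 < e"
  then have "0 < e / (cmod a + 1)" by (simp add: add_nonneg_pos)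
  then obtain c where c: "finite {n. c n \<noteq> 0}" "Lp_norm p (\<lambda>z. f z - trig_poly c z) < e / (cmod a + 1)"
    using assms unfolding trig_approx_def by meson
  have "Lp_norm p (\<lambda>z. a * f z - trig_poly (\<lambda>n. a * c n) z) = cmod a * Lp_norm p (\<lambda>z. f z - trig_poly c z)"
    using assms by (simp add: trig_poly_cmult Lp_norm_cmult flip: right_diff_distrib)
  also have "\<dots> \<le> cmod a * (e / (cmod a + 1))"
    using c by (intro mult_left_mono) auto
  also have "\<dots> < e"
  proof -
    have "0 < cmod a + 1" by (simp add: add_nonneg_pos)
    then show ?thesis using e by (simp add: pos_divide_less_eq algebra_simps)
  qed
  finally show "\<exists>c. finite {n. c n \<noteq> 0} \<and> Lp_norm p (\<lambda>z. a * f z - trig_poly c z) < e"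
    using finite_support_cmult[OF c(1)] by (intro exI conjI)
qed

lemma trig_approx_continuous:
  assumes p: "1 \<le> p" and cont: "continuous_on (sphere 0 1) f"
  shows "trig_approx p f"
  unfolding trig_approx_def
proof (intro conjI allI impI)
  show f: "f \<in> Lp p" using assms by (simp add: Lp_continuous)
  fix e :: real assume e: "0 < e"
  then obtain c where c: "finite {n. c n \<noteq> 0}" "\<And>z. z \<in> sphere 0 1 \<Longrightarrow> cmod (f z - trig_poly c z) < e / 2"
    using trig_poly_uniformly_dense[OF cont, of "e / 2"] by (metis half_gt_zero)
  have "Lp_norm p (\<lambda>z. f z - trig_poly c z) \<le> e / 2"
  proof (rule Lp_norm_le_sup)
    show "(\<lambda>z. f z - trig_poly c z) \<in> Lp p"
      using p by (simp add: Lp_diff f trig_poly_in_Lp)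
  qed (use c(2) e p in \<open>auto intro: less_imp_le\<close>)
  then show "\<exists>c. finite {n. c n \<noteq> 0} \<and> Lp_norm p (\<lambda>z. f z - trig_poly c z) < e"
    using c(1) e by (intro exI[of _ c]) auto
qed

lemma trig_approx_sum:
  assumes "1 \<le> p" "finite A" "\<And>i. i \<in> A \<Longrightarrow> trig_approx p (f i)"
  shows "trig_approx p (\<lambda>z. \<Sum>i\<in>A. f i z)"
  using assms(2,3)
  by (induction A rule: finite_induct)
    (auto intro: trig_approx_add trig_approx_continuous continuous_intros assms(1))

text \<open>Dominated convergence applied to the p-th powers of the errors turns pointwise into norm
  convergence. It serves both the indicators of compact sets and the passage from simple functions
  to all of \<open>Lp p\<close>.\<close>

lemma trig_approx_dominated:
  assumes p: "1 \<le> p" and f: "f \<in> Lp p" and s: "\<And>i. trig_approx p (s i)"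
    and lim: "\<And>z. z \<in> sphere 0 1 \<Longrightarrow> (\<lambda>i. s i z) \<longlonglongrightarrow> f z"
    and h: "integrable circle h" "\<And>i z. z \<in> sphere 0 1 \<Longrightarrow> cmod (f z - s i z) powr p \<le> h z"
  shows "trig_approx p f"
proof (rule trig_approx_closed[OF p f])
  fix e :: real assume e: "0 < e"
  have sL: "s i \<in> Lp p" for i using s by (simp add: trig_approx_def)
  have "(\<lambda>i. LINT z|circle. cmod (f z - s i z) powr p) \<longlonglongrightarrow> (LINT z|circle. 0)"
  proof (rule integral_dominated_convergence[OF _ _ h(1)])
    show "AE z in circle. (\<lambda>i. cmod (f z - s i z) powr p) \<longlonglongrightarrow> 0"
    proof (rule AE_I2)
      fix z assume "z \<in> space circle"
      then have "(\<lambda>i. f z - s i z) \<longlonglongrightarrow> f z - f z"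
        by (intro tendsto_intros lim) (simp add: space_circle)
      then have "(\<lambda>i. cmod (f z - s i z)) \<longlonglongrightarrow> 0" by (simp add: tendsto_norm_zero)
      then show "(\<lambda>i. cmod (f z - s i z) powr p) \<longlonglongrightarrow> 0"
        using p by (auto intro!: tendsto_zero_powrI[OF _ tendsto_const] always_eventually)
    qed
    show "AE z in circle. norm (cmod (f z - s i z) powr p) \<le> h z" for i
      using h(2) by (intro AE_I2) (simp add: space_circle)
  qed (use f sL Lp_measurable in measurable)
  then have "\<forall>\<^sub>F i in sequentially. (LINT z|circle. cmod (f z - s i z) powr p) < (e / 2) powr p"
    using e by (intro order_tendstoD) auto
  then obtain i where "(LINT z|circle. cmod (f z - s i z) powr p) < (e / 2) powr p"
    using eventually_happens trivial_limit_sequentially by blast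
  then have "Lp_norm p (\<lambda>z. f z - s i z) \<le> e / 2"
    using e p by (subst Lp_norm_le_iff) auto
  then show "\<exists>g. trig_approx p g \<and> Lp_norm p (\<lambda>z. f z - g z) < e"
    using s e by (intro exI[of _ "s i"]) auto
qed

lemma indicator_in_Lp:
  assumes "B \<in> sets borel" "1 \<le> p"
  shows "(\<lambda>z. indicator B z :: complex) \<in> Lp p"
proof (rule LpI_bound)
  have "B \<inter> sphere 0 1 \<in> sets circle"
    using assms(1) by (auto simp: sets_circle sets_restrict_space)
  then have "(\<lambda>z. indicator (B \<inter> sphere 0 1) z :: complex) \<in> borel_measurable circle" by simp
  then show "(\<lambda>z. indicator B z :: complex) \<in> borel_measurable circle"
    by (rule measurable_cong[THEN iffD1, rotated]) (auto simp: space_circle split: split_indicator)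
  show "integrable circle (\<lambda>_. 1 :: real)" by simp
qed (use assms in \<open>auto split: split_indicator\<close>)

lemma trig_approx_indicator_compact:
  assumes p: "1 \<le> p" and K: "compact K"
  shows "trig_approx p (\<lambda>z. indicator K z)"
\<comment> \<open>\<open>infdist\<close> to the empty set is 0, so the functions below would be
  constantly 1 instead of tending to 0.\<close>
proof (cases "K = {}")
  case True
  then show ?thesis using trig_approx_continuous[OF p, of "\<lambda>_. 0"] by (simp add: continuous_on_const)
next
  case False
  \<comment> \<open>Continuous tents equal to 1 on K and supported within distance 1 / i of it; they
    decrease pointwise to the indicator since K is closed.\<close>
  define \<phi> where "\<phi> i z = max 0 (1 - real i * infdist z K)" for i and z :: complex
  have range: "0 \<le> \<phi> i z" "\<phi> i z \<le> 1" for i z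
    by (auto simp: \<phi>_def infdist_nonneg)
  have on_K: "\<phi> i z = 1" if "z \<in> K" for i z using that by (simp add: \<phi>_def)
  show ?thesis
  proof (rule trig_approx_dominated[OF p, where s = "\<lambda>i z. of_real (\<phi> i z)" and h = "\<lambda>_. 1"])
    show "(\<lambda>z. indicator K z :: complex) \<in> Lp p"
      using K p by (intro indicator_in_Lp) (auto intro: borel_closed compact_imp_closed)
    show "trig_approx p (\<lambda>z. of_real (\<phi> i z))" for i
      unfolding \<phi>_def by (intro trig_approx_continuous p continuous_intros)
    show "(\<lambda>i. of_real (\<phi> i z)) \<longlonglongrightarrow> (indicator K z :: complex)" for z
    proof (cases "z \<in> K")
      case True then show ?thesis by (simp add: on_K)
    next
      case notin: False
      then have d: "0 < infdist z K"
        using K False infdist_pos_not_in_closed compact_imp_closed by blast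
      obtain N :: nat where N: "1 / infdist z K < N" using reals_Archimedean2 by blast
      have "\<phi> i z = 0" if "N \<le> i" for i
      proof -
        have "1 / infdist z K < i" using N that by simp
        then have "1 < i * infdist z K" using d by (simp add: field_simps)
        then show ?thesis by (simp add: \<phi>_def)
      qed
      then have "\<forall>\<^sub>F i in sequentially. of_real (\<phi> i z) = (indicator K z :: complex)"
        using notin by (auto simp: eventually_sequentially)
      then show ?thesis by (rule tendsto_eventually)
    qed
    show "cmod (indicator K z - of_real (\<phi> i z)) powr p \<le> 1" for i z
    proof -
      have "cmod (indicator K z - of_real (\<phi> i z)) \<le> 1"
        using range[of i z] on_K[of z i] by (auto split: split_indicator)
      then show ?thesis using p by (intro powr_le1) auto
    qed
  qed simp
qed

text \<open>Inner regularity gives a compact K inside B with B - K of measure below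
  \<open>(e / 2) powr p\<close>, and that measure is the p-th power of the norm of the difference of
  the indicators.\<close>

lemma trig_approx_indicator:
  assumes p: "1 \<le> p" and B: "B \<in> sets borel"
  shows "trig_approx p (\<lambda>z. indicator B z)"
proof (rule trig_approx_closed[OF p indicator_in_Lp[OF B p]])
  fix e :: real assume e: "0 < e"
  \<comment> \<open>The space of \<open>circle\<close> is the sphere alone, whereas inner regularity
    concerns a Borel measure on the whole plane.\<close>
  define M where "M = distr circle borel (\<lambda>z. z)"
  have id: "(\<lambda>z. z) \<in> borel_measurable circle"
    by (intro continuous_imp_measurable_circle continuous_intros)
  have "emeasure M B = (SUP K \<in> {K. K \<subseteq> B \<and> compact K}. emeasure M K)"
    using B by (intro inner_regular)
      (auto simp: M_def emeasure_distr id emeasure_space_circle)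
  moreover have "emeasure M B \<noteq> \<infinity>"
    using B id by (simp add: M_def emeasure_distr circle.emeasure_finite)
  moreover have "0 < (e / 2) powr p" using e by simp
  moreover have "{K. K \<subseteq> B \<and> compact K} \<noteq> {}" by blast
  ultimately have "\<exists>K\<in>{K. K \<subseteq> B \<and> compact K}. emeasure M B < emeasure M K + ennreal ((e / 2) powr p)"
    by (intro SUP_approx_ennreal) simp_all
  then obtain K where K: "K \<subseteq> B" "compact K"
    and lt: "emeasure M B < emeasure M K + ennreal ((e / 2) powr p)"
    by auto
  have Kb: "K \<in> sets borel" using K by (auto intro: borel_closed compact_imp_closed)
  have mM: "emeasure M A = emeasure circle (A \<inter> sphere 0 1)" if "A \<in> sets borel" for A
    using that id by (simp add: M_def emeasure_distr space_circle)
  have sc: "A \<inter> sphere 0 1 \<in> sets circle" if "A \<in> sets borel" for A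
    using that by (auto simp: sets_circle sets_restrict_space)
  have "ennreal (measure circle (B \<inter> sphere 0 1)) < ennreal (measure circle (K \<inter> sphere 0 1) + (e / 2) powr p)"
    using lt by (simp add: mM B Kb circle.emeasure_eq_measure)
  then have "measure circle (B \<inter> sphere 0 1) < measure circle (K \<inter> sphere 0 1) + (e / 2) powr p"
    by (subst (asm) ennreal_less_iff) auto
  moreover have "measure circle (B \<inter> sphere 0 1 - K \<inter> sphere 0 1)
      = measure circle (B \<inter> sphere 0 1) - measure circle (K \<inter> sphere 0 1)"
    using K B Kb by (intro circle.finite_measure_Diff sc) auto
  moreover have "(LINT z|circle. cmod (indicator B z - indicator K z) powr p)
     = (LINT z|circle. indicator (B \<inter> sphere 0 1 - K \<inter> sphere 0 1) z)"
    using K p by (intro Bochner_Integration.integral_cong) (auto simp: space_circle split: split_indicator)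
  moreover have "\<dots> = measure circle (B \<inter> sphere 0 1 - K \<inter> sphere 0 1)"
  proof -
    have "(B \<inter> sphere 0 1 - K \<inter> sphere 0 1) \<inter> space circle = B \<inter> sphere 0 1 - K \<inter> sphere 0 1"
      by (auto simp: space_circle)
    then show ?thesis by (simp only: Bochner_Integration.integral_indicator)
  qed
  ultimately have "(LINT z|circle. cmod (indicator B z - indicator K z) powr p) \<le> (e / 2) powr p"
    by simp
  then have "Lp_norm p (\<lambda>z. indicator B z - indicator K z) \<le> e / 2"
    using e p by (subst Lp_norm_le_iff) auto
  then show "\<exists>g. trig_approx p g \<and> Lp_norm p (\<lambda>z. indicator B z - g z) < e"
    using trig_approx_indicator_compact[OF p K(2)] e by (intro exI conjI) auto
qed

lemma trig_approx_cong:
  assumes "trig_approx p f" "\<And>z. z \<in> sphere 0 1 \<Longrightarrow> g z = f z"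
  shows "trig_approx p g"
proof -
  have 1: "g \<in> Lp p \<longleftrightarrow> f \<in> Lp p"
    unfolding Lp_def mem_Collect_eq using assms(2)
    by (intro conj_cong measurable_cong Bochner_Integration.integrable_cong) (auto simp: space_circle)
  have 2: "Lp_norm p (\<lambda>z. g z - trig_poly c z) = Lp_norm p (\<lambda>z. f z - trig_poly c z)" for c
    unfolding Lp_norm_def using assms(2)
    by (intro arg_cong[where f = "\<lambda>x. x powr (1 / p)"] Bochner_Integration.integral_cong)
       (auto simp: space_circle)
  show ?thesis using assms(1) unfolding trig_approx_def 1 2 .
qed

lemma trig_approx_simple_function:
  assumes p: "1 \<le> p" and s: "simple_function circle s"
  shows "trig_approx p s"
proof -
  let ?A = "\<lambda>y. s -` {y} \<inter> space circle"
  have "?A y \<in> sets borel" for y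
    using simple_functionD(2)[OF s, of "{y}"] by (auto simp: sets_circle sets_restrict_space)
  then have "trig_approx p (\<lambda>z. \<Sum>y\<in>s ` space circle. y * indicator (?A y) z)"
    using simple_functionD(1)[OF s]
    by (intro trig_approx_sum trig_approx_cmult trig_approx_indicator p)
  then show ?thesis
  proof (rule trig_approx_cong)
    fix z :: complex assume "z \<in> sphere 0 1"
    then have z: "z \<in> space circle" by (simp add: space_circle)
    have "(\<Sum>y\<in>s ` space circle. y * indicator (?A y) z) = (\<Sum>y\<in>s ` space circle. if y = s z then y else 0)"
      using z by (intro sum.cong) (auto split: split_indicator)
    then show "s z = (\<Sum>y\<in>s ` space circle. y * indicator (?A y) z)"
      using z simple_functionD(1)[OF s] by simp
  qed
qed

theorem trig_poly_dense_Lp: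
  assumes p: "1 \<le> p" and f: "f \<in> Lp p"
  shows "trig_approx p f"
proof -
  obtain s where s: "\<And>i. simple_function circle (s i)"
    and lim: "\<And>z. z \<in> space circle \<Longrightarrow> (\<lambda>i. s i z) \<longlonglongrightarrow> f z"
    and bound: "\<And>i z. z \<in> space circle \<Longrightarrow> dist (s i z) 0 \<le> 2 * dist (f z) 0"
    using borel_measurable_implies_sequence_metric[OF Lp_measurable[OF f], of 0] by metis
  show ?thesis
  proof (rule trig_approx_dominated[OF p f, of s "\<lambda>z. 3 powr p * cmod (f z) powr p"])
    show "trig_approx p (s i)" for i by (rule trig_approx_simple_function[OF p s])
    show "integrable circle (\<lambda>z. 3 powr p * cmod (f z) powr p)"
      using Lp_integrable[OF f] by simp
    fix i and z :: complex assume "z \<in> sphere 0 1"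
    then have z: "z \<in> space circle" by (simp add: space_circle)
    show "(\<lambda>i. s i z) \<longlonglongrightarrow> f z" by (rule lim[OF z])
    \<comment> \<open>The factor is 1 + 2, since the approximating simple functions satisfy |s i z|
      \<le> 2 |f z|.\<close>
    have "cmod (f z - s i z) \<le> 3 * cmod (f z)"
      using norm_triangle_ineq4[of "f z" "s i z"] bound[OF z, of i] by simp
    then have "cmod (f z - s i z) powr p \<le> (3 * cmod (f z)) powr p"
      using p by (intro powr_mono2) auto
    then show "cmod (f z - s i z) powr p \<le> 3 powr p * cmod (f z) powr p"
      by (simp add: powr_mult)
  qed
qed

subsection \<open>Extension to \<open>L\<^sup>p\<close>\<close>

text \<open>Fatou's lemma in the nonnegative integral yields integrability of the limit and its norm
  bound together. Bounds B k that vary with k are allowed because the estimates in the extension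
  carry a vanishing error.\<close>

lemma Lp_Fatou:
  assumes p: "0 < p" and h: "\<And>k. h k \<in> Lp p" and g: "g \<in> borel_measurable circle"
    and lim: "AE z in circle. (\<lambda>k. h k z) \<longlonglongrightarrow> g z"
    and bound: "\<And>k. Lp_norm p (h k) \<le> B k" "B \<longlonglongrightarrow> b"
  shows "g \<in> Lp p" "Lp_norm p g \<le> b"
proof -
  have B: "0 \<le> B k" for k using order_trans[OF Lp_norm_nonneg bound(1)] .
  have b: "0 \<le> b" using LIMSEQ_le_const[OF bound(2), of 0] B by blast
  have "(\<integral>\<^sup>+z. ennreal (cmod (g z) powr p) \<partial>circle)
      = (\<integral>\<^sup>+z. liminf (\<lambda>k. ennreal (cmod (h k z) powr p)) \<partial>circle)"
  proof (rule nn_integral_cong_AE)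
    show "AE z in circle. ennreal (cmod (g z) powr p) = liminf (\<lambda>k. ennreal (cmod (h k z) powr p))"
      using lim
    proof eventually_elim
      case (elim z)
      have "(\<lambda>k. ennreal (cmod (h k z) powr p)) \<longlonglongrightarrow> ennreal (cmod (g z) powr p)"
        using p by (intro tendsto_ennrealI tendsto_powr' tendsto_norm elim tendsto_const) auto
      from lim_imp_Liminf[OF sequentially_bot this] show ?case by simp
    qed
  qed
  also have "\<dots> \<le> liminf (\<lambda>k. \<integral>\<^sup>+z. ennreal (cmod (h k z) powr p) \<partial>circle)"
    by (intro nn_integral_liminf measurable_compose[OF _ measurable_ennreal]
        borel_measurable_integrable Lp_integrable h)
  also have "\<dots> \<le> liminf (\<lambda>k. ennreal (B k powr p))"
  proof (intro Liminf_mono always_eventually allI)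
    fix k
    have "(\<integral>\<^sup>+z. ennreal (cmod (h k z) powr p) \<partial>circle) = ennreal (LINT z|circle. cmod (h k z) powr p)"
      by (rule nn_integral_eq_integral[OF Lp_integrable[OF h]]) simp
    also have "\<dots> \<le> ennreal (B k powr p)"
      using bound(1)[of k] Lp_norm_le_iff[OF p B] by (intro ennreal_leI) blast
    finally show "(\<integral>\<^sup>+z. ennreal (cmod (h k z) powr p) \<partial>circle) \<le> ennreal (B k powr p)" .
  qed
  also have "\<dots> = ennreal (b powr p)"
  proof (rule lim_imp_Liminf[OF sequentially_bot])
    show "(\<lambda>k. ennreal (B k powr p)) \<longlonglongrightarrow> ennreal (b powr p)"
      using p B by (intro tendsto_ennrealI tendsto_powr' bound(2) tendsto_const) auto
  qed
  finally have le: "(\<integral>\<^sup>+z. ennreal (cmod (g z) powr p) \<partial>circle) \<le> ennreal (b powr p)" .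
  also have "\<dots> < \<infinity>" by simp
  finally have int: "integrable circle (\<lambda>z. cmod (g z) powr p)"
    using g by (intro integrableI_nonneg) auto
  then show "g \<in> Lp p" using g by (simp add: Lp_def)
  have "ennreal (LINT z|circle. cmod (g z) powr p) \<le> ennreal (b powr p)"
    using le nn_integral_eq_integral[OF int] by simp
  then have "(LINT z|circle. cmod (g z) powr p) \<le> b powr p" by simp
  then show "Lp_norm p g \<le> b" using Lp_norm_le_iff[OF p b] by simp
qed

text \<open>Hoelder against the constant 1, whose norm is 1 because the circle has total mass
  1.\<close>

lemma L1_norm_le_Lp_norm:
  assumes f: "f \<in> Lp p" and pq: "1 < p"
  shows "(LINT z|circle. cmod (f z)) \<le> Lp_norm p f" "integrable circle (\<lambda>z. cmod (f z))"
proof -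
  define q where "q = p / (p - 1)"
  have q: "1 < q" "1 / p + 1 / q = 1" using pq by (auto simp: q_def field_simps)
  have F: "(\<lambda>z. of_real (cmod (f z))) \<in> Lp p"
    using f by (auto simp: Lp_def)
  have one: "(\<lambda>z. 1) \<in> Lp q" using q by (intro Lp_continuous) auto
  have "cmod (LINT z|circle. of_real (cmod (f z)) * 1) \<le> Lp_norm p (\<lambda>z. of_real (cmod (f z))) * Lp_norm q (\<lambda>z. 1)"
    by (rule Lp_Holder[OF F one pq q])
  then show "(LINT z|circle. cmod (f z)) \<le> Lp_norm p f"
    by (simp add: Lp_norm_def)
  show "integrable circle (\<lambda>z. cmod (f z))"
  proof (rule Bochner_Integration.integrable_bound)
    show "integrable circle (\<lambda>z. 1 + cmod (f z) powr p)" using Lp_integrable[OF f] by simp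
    have "x \<le> 1 + x powr p" if "0 \<le> x" for x :: real
    proof (cases "x \<le> 1")
      case False
      then have "x powr 1 \<le> x powr p" using pq by (intro powr_mono) auto
      then show ?thesis using False by simp
    qed (simp add: add_increasing2)
    then show "AE z in circle. norm (cmod (f z)) \<le> norm (1 + cmod (f z) powr p)"
      by (intro AE_I2) (simp add: abs_of_nonneg add_nonneg_nonneg)
  qed (rule measurable_compose[OF Lp_measurable[OF f] borel_measurable_norm])
qed

text \<open>The Riesz-Fischer argument: the increments have summable L1 norms, so by monotone
  convergence the sum of their moduli has finite integral and is finite almost everywhere; there the
  telescoping series converges.\<close>

lemma Lp_fast_Cauchy_AE_convergent:
  assumes p: "1 < p" and h: "\<And>k. h k \<in> Lp p"
    and fast: "\<And>k. Lp_norm p (\<lambda>z. h (Suc k) z - h k z) \<le> M * (1 / 2) ^ k"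
  shows "AE z in circle. convergent (\<lambda>k. h k z)"
proof -
  define d where "d k z = cmod (h (Suc k) z - h k z)" for k z
  have M: "0 \<le> M" using order_trans[OF Lp_norm_nonneg fast[of 0]] by simp
  have hd: "(\<lambda>z. h (Suc k) z - h k z) \<in> Lp p" for k using p by (intro Lp_diff h) auto
  have dm: "d k \<in> borel_measurable circle" for k
    unfolding d_def by (rule measurable_compose[OF Lp_measurable[OF hd] borel_measurable_norm])
  then have dm': "(\<lambda>z. ennreal (d k z)) \<in> borel_measurable circle" for k
    by (intro measurable_compose[OF _ measurable_ennreal])
  have "(\<integral>\<^sup>+z. (\<Sum>k. ennreal (d k z)) \<partial>circle) = (\<Sum>k. \<integral>\<^sup>+z. ennreal (d k z) \<partial>circle)"
    by (intro nn_integral_suminf dm')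
  also have "\<dots> \<le> (\<Sum>k. ennreal (M * (1 / 2) ^ k))"
  proof (intro suminf_le summableI)
    fix k
    have "(\<integral>\<^sup>+z. ennreal (d k z) \<partial>circle) = ennreal (LINT z|circle. d k z)"
      unfolding d_def by (rule nn_integral_eq_integral[OF L1_norm_le_Lp_norm(2)[OF hd p]]) simp
    also have "\<dots> \<le> ennreal (M * (1 / 2) ^ k)"
      unfolding d_def by (intro ennreal_leI order_trans[OF L1_norm_le_Lp_norm(1)[OF hd p] fast])
    finally show "(\<integral>\<^sup>+z. ennreal (d k z) \<partial>circle) \<le> ennreal (M * (1 / 2) ^ k)" .
  qed
  also have "\<dots> = ennreal (\<Sum>k. M * (1 / 2) ^ k)"
    using M by (intro suminf_ennreal2 summable_mult summable_geometric) auto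
  finally have "(\<integral>\<^sup>+z. (\<Sum>k. ennreal (d k z)) \<partial>circle) \<noteq> \<infinity>"
    using neq_top_trans by (auto simp: top_unique)
  then have "AE z in circle. (\<Sum>k. ennreal (d k z)) \<noteq> \<infinity>"
    by (intro nn_integral_PInf_AE borel_measurable_suminf_order dm')
  then show ?thesis
  proof eventually_elim
    case (elim z)
    then have "summable (\<lambda>k. d k z)"
      by (intro summable_suminf_not_top) (auto simp: d_def)
    then have "summable (\<lambda>k. h (Suc k) z - h k z)"
      unfolding d_def by (rule summable_norm_cancel)
    then have "convergent (\<lambda>n. \<Sum>k<n. h (Suc k) z - h k z)"
      by (simp add: summable_iff_convergent)
    then have "convergent (\<lambda>n. h 0 z + (h n z - h 0 z))"
      by (intro convergent_add convergent_const) (simp add: sum_lessThan_telescope[of "\<lambda>n. h n z"])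
    then show ?case by simp
  qed
qed

lemma trig_poly_diff:
  assumes "finite {n. c n \<noteq> 0}" "finite {n. d n \<noteq> 0}"
  shows "trig_poly (\<lambda>n. c n + - 1 * d n) z = trig_poly c z - trig_poly d z"
  using assms by (simp only: trig_poly_add finite_support_cmult trig_poly_cmult) simp

text \<open>Describes the image of f without reference to an approximating sequence: h is as close
  to each projected polynomial, up to the factor K, as f is to the polynomial. The zero polynomial
  gives the norm bound, and f = \<open>trig_poly c\<close> forces h to be the projection almost
  everywhere.\<close>

definition riesz_rel :: "real \<Rightarrow> real \<Rightarrow> (complex \<Rightarrow> complex) \<Rightarrow> (complex \<Rightarrow> complex) \<Rightarrow> bool" where
  "riesz_rel K p f h \<longleftrightarrow> h \<in> Lp p \<and> (\<forall>c. finite {n. c n \<noteq> 0} \<longrightarrow>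
     Lp_norm p (\<lambda>z. h z - trig_poly (riesz_coeffs c) z) \<le> K * Lp_norm p (\<lambda>z. f z - trig_poly c z))"

text \<open>Polynomials converging to f at rate 2^(-k) have projections converging at a summable
  rate, hence almost everywhere. The pointwise limit is a concrete function, and Fatou carries the
  defining estimates over to it.\<close>

lemma riesz_rel_total:
  assumes p: "1 < p" and K: "0 \<le> K" "\<And>c. finite {n. c n \<noteq> 0} \<Longrightarrow>
      Lp_norm p (trig_poly (riesz_coeffs c)) \<le> K * Lp_norm p (trig_poly c)"
    and f: "f \<in> Lp p"
  shows "\<exists>h. riesz_rel K p f h"
proof -
  have p1: "1 \<le> p" and p0: "0 < p" using p by auto
  have "\<exists>c. finite {n. c n \<noteq> 0} \<and> Lp_norm p (\<lambda>z. f z - trig_poly c z) < (1 / 2) ^ k" for k :: nat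
    using trig_poly_dense_Lp[OF p1 f] unfolding trig_approx_def by simp
  then obtain c where c: "\<And>k. finite {n. c k n \<noteq> 0}"
    and fc: "\<And>k. Lp_norm p (\<lambda>z. f z - trig_poly (c k) z) < (1 / 2) ^ k" by metis
  define h where "h k = trig_poly (riesz_coeffs (c k))" for k
  have h: "h k \<in> Lp p" for k unfolding h_def using p by (intro trig_poly_in_Lp) simp
  have tp: "trig_poly d \<in> Lp p" for d using p by (intro trig_poly_in_Lp) simp
  have diff: "Lp_norm p (\<lambda>z. trig_poly (riesz_coeffs a) z - trig_poly (riesz_coeffs b) z)
      \<le> K * Lp_norm p (\<lambda>z. trig_poly a z - trig_poly b z)"
    if "finite {n. a n \<noteq> 0}" "finite {n. b n \<noteq> 0}" for a b
  proof -
    let ?d = "\<lambda>n. a n + - 1 * b n"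
    have "trig_poly (riesz_coeffs ?d) = (\<lambda>z. trig_poly (riesz_coeffs a) z - trig_poly (riesz_coeffs b) z)"
      by (intro ext) (simp only: riesz_coeffs_add riesz_coeffs_cmult trig_poly_diff[OF finite_support_riesz finite_support_riesz] that)
    moreover have "trig_poly ?d = (\<lambda>z. trig_poly a z - trig_poly b z)"
      by (intro ext trig_poly_diff that)
    ultimately show ?thesis
      using K(2)[OF finite_support_add[OF that(1) finite_support_cmult[OF that(2)], of "- 1"]] by simp
  qed
  \<comment> \<open>Used twice: a = \<open>c k\<close>, with index Suc k, gives the rate of the
    increments, and arbitrary a gives in the limit the estimate that \<open>riesz_rel\<close>
    demands.\<close>
  have step: "Lp_norm p (\<lambda>z. h k z - trig_poly (riesz_coeffs a) z)
      \<le> K * ((1 / 2) ^ k + Lp_norm p (\<lambda>z. f z - trig_poly a z))" if "finite {n. a n \<noteq> 0}" for k a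
  proof -
    have "Lp_norm p (\<lambda>z. trig_poly (c k) z - trig_poly a z)
        \<le> Lp_norm p (\<lambda>z. trig_poly (c k) z - f z) + Lp_norm p (\<lambda>z. f z - trig_poly a z)"
      by (intro Lp_norm_triangle_diff tp f p1)
    also have "\<dots> \<le> (1 / 2) ^ k + Lp_norm p (\<lambda>z. f z - trig_poly a z)"
      using fc[of k] by (simp add: Lp_norm_minus_commute[of p "trig_poly (c k)" f])
    finally have "K * Lp_norm p (\<lambda>z. trig_poly (c k) z - trig_poly a z)
        \<le> K * ((1 / 2) ^ k + Lp_norm p (\<lambda>z. f z - trig_poly a z))"
      using K(1) by (intro mult_left_mono)
    with diff[OF c that, of k] show ?thesis unfolding h_def by linarith
  qed
  have "Lp_norm p (\<lambda>z. h (Suc k) z - h k z) \<le> (K * 2) * (1 / 2) ^ k" for k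
  proof -
    have "Lp_norm p (\<lambda>z. h (Suc k) z - h k z) \<le> K * ((1 / 2) ^ Suc k + (1 / 2) ^ k)"
      using step[OF c, of "Suc k" k] fc[of k] K(1)
      unfolding h_def by (meson add_left_mono less_imp_le mult_left_mono order_trans)
    also have "\<dots> \<le> K * (2 * (1 / 2) ^ k)"
      using K(1) by (intro mult_left_mono) simp_all
    finally show ?thesis by simp
  qed
  from Lp_fast_Cauchy_AE_convergent[of p h, OF p h this]
  have conv: "AE z in circle. (\<lambda>k. h k z) \<longlonglongrightarrow> lim (\<lambda>k. h k z)"
    by (simp only: convergent_LIMSEQ_iff)
  define g where "g z = lim (\<lambda>k. h k z)" for z
  have gm: "g \<in> borel_measurable circle"
    unfolding g_def using h[THEN Lp_measurable] by (rule borel_measurable_lim_metric)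
  have main: "(\<lambda>z. g z - trig_poly (riesz_coeffs a) z) \<in> Lp p \<and>
      Lp_norm p (\<lambda>z. g z - trig_poly (riesz_coeffs a) z) \<le> K * Lp_norm p (\<lambda>z. f z - trig_poly a z)"
    if a: "finite {n. a n \<noteq> 0}" for a
  proof -
    have 1: "(\<lambda>z. h k z - trig_poly (riesz_coeffs a) z) \<in> Lp p" for k
      by (intro Lp_diff h tp p1)
    have 2: "(\<lambda>z. g z - trig_poly (riesz_coeffs a) z) \<in> borel_measurable circle"
      using gm Lp_measurable[OF tp] by (intro borel_measurable_diff)
    have 3: "AE z in circle. (\<lambda>k. h k z - trig_poly (riesz_coeffs a) z)
        \<longlonglongrightarrow> g z - trig_poly (riesz_coeffs a) z"
      using conv unfolding g_def by eventually_elim (intro tendsto_intros)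
    have 4: "(\<lambda>k. K * ((1 / 2) ^ k + Lp_norm p (\<lambda>z. f z - trig_poly a z)))
        \<longlonglongrightarrow> K * (0 + Lp_norm p (\<lambda>z. f z - trig_poly a z))"
      by (intro tendsto_intros LIMSEQ_power_zero) simp
    from Lp_Fatou[OF p0 1 2 3 step[OF a] 4] show ?thesis by simp
  qed
  \<comment> \<open>The zero polynomial in \<open>main\<close> turns the statement about differences
    into membership of g itself.\<close>
  have "(\<lambda>z. 0) = trig_poly (riesz_coeffs (\<lambda>_. 0))"
    by (auto simp: trig_poly_def riesz_coeffs_def)
  then have "g \<in> Lp p" using main[of "\<lambda>_. 0"] by (simp add: trig_poly_def riesz_coeffs_def)
  then show ?thesis using main unfolding riesz_rel_def by blast
qed

text \<open>Approximating \<open>f\<close> and \<open>g\<close> by trigonometric polynomials transfers the linearity of the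
  projection on coefficients; \<open>g = 0\<close> and \<open>a = 1\<close> give uniqueness up to null sets.\<close>

lemma riesz_rel_linear:
  assumes p: "1 < p" and K: "0 \<le> K" and f: "f \<in> Lp p" and g: "g \<in> Lp p" and l: "l \<in> Lp p"
    and R: "riesz_rel K p f hf" "riesz_rel K p g hg" "riesz_rel K p l hl"
    and eq: "AE z in circle. l z = a * f z + g z"
  shows "AE z in circle. hl z = a * hf z + hg z"
proof -
  have p1: "1 \<le> p" and p0: "0 < p" using p by auto
  have tp: "trig_poly d \<in> Lp p" for d using p by (intro trig_poly_in_Lp) simp
  have H: "hf \<in> Lp p" "hg \<in> Lp p" "hl \<in> Lp p" using R by (auto simp: riesz_rel_def)
  note Lp_intros = Lp_add Lp_diff Lp_cmult H f g l tp p1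
  let ?h = "\<lambda>z. a * hf z + hg z"
  have tri: "Lp_norm p (\<lambda>z. a * u z + v z) \<le> cmod a * Lp_norm p u + Lp_norm p v"
    if "u \<in> Lp p" "v \<in> Lp p" for u v
    using Lp_norm_triangle[OF Lp_cmult[OF that(1), of a] that(2) p1] by (simp add: Lp_norm_cmult[OF p0])
  have "Lp_norm p (\<lambda>z. hl z - ?h z) \<le> e" if e: "0 < e" for e
  proof -
    \<comment> \<open>The accumulated error is 2 * K * (cmod a + 1) * \<delta>; the additional 1
      keeps the denominator positive when K = 0.\<close>
    define \<delta> where "\<delta> = e / (2 * K * (cmod a + 1) + 1)"
    have den: "0 < 2 * K * (cmod a + 1) + 1" using K by (intro add_nonneg_pos mult_nonneg_nonneg) auto
    have \<delta>: "0 < \<delta>" using e den by (simp add: \<delta>_def)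
    obtain c where c: "finite {n. c n \<noteq> 0}" "Lp_norm p (\<lambda>z. f z - trig_poly c z) < \<delta>"
      using trig_poly_dense_Lp[OF p1 f] \<delta> unfolding trig_approx_def by blast
    obtain d where d: "finite {n. d n \<noteq> 0}" "Lp_norm p (\<lambda>z. g z - trig_poly d z) < \<delta>"
      using trig_poly_dense_Lp[OF p1 g] \<delta> unfolding trig_approx_def by blast
    let ?b = "\<lambda>n. a * c n + d n"
    have b: "finite {n. ?b n \<noteq> 0}" by (intro finite_support_add finite_support_cmult c d)
    have tb: "trig_poly ?b z = a * trig_poly c z + trig_poly d z" for z
      by (simp add: trig_poly_add trig_poly_cmult finite_support_cmult c d)
    have rb: "trig_poly (riesz_coeffs ?b) z = a * trig_poly (riesz_coeffs c) z + trig_poly (riesz_coeffs d) z" for z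
      by (simp add: riesz_coeffs_add riesz_coeffs_cmult trig_poly_add trig_poly_cmult finite_support_cmult
          finite_support_riesz c d)
    have "Lp_norm p (\<lambda>z. l z - trig_poly ?b z)
        = Lp_norm p (\<lambda>z. a * (f z - trig_poly c z) + (g z - trig_poly d z))"
    proof (rule Lp_norm_cong_AE)
      show "AE z in circle. l z - trig_poly ?b z = a * (f z - trig_poly c z) + (g z - trig_poly d z)"
        using eq by eventually_elim (simp only: tb, simp add: algebra_simps)
      show "(\<lambda>z. l z - trig_poly ?b z) \<in> borel_measurable circle"
        by (rule Lp_measurable[of _ p]) (intro Lp_intros)
      show "(\<lambda>z. a * (f z - trig_poly c z) + (g z - trig_poly d z)) \<in> borel_measurable circle"
        by (rule Lp_measurable[of _ p]) (intro Lp_intros)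
    qed
    also have "\<dots> \<le> cmod a * Lp_norm p (\<lambda>z. f z - trig_poly c z) + Lp_norm p (\<lambda>z. g z - trig_poly d z)"
      by (intro tri Lp_intros)
    also have "\<dots> \<le> cmod a * \<delta> + \<delta>"
      using c d by (intro add_mono mult_left_mono) auto
    finally have "K * Lp_norm p (\<lambda>z. l z - trig_poly ?b z) \<le> K * (cmod a * \<delta> + \<delta>)"
      using K by (intro mult_left_mono)
    then have 1: "Lp_norm p (\<lambda>z. hl z - trig_poly (riesz_coeffs ?b) z) \<le> K * (cmod a * \<delta> + \<delta>)"
      using R(3) b unfolding riesz_rel_def by (meson order_trans)
    have F: "Lp_norm p (\<lambda>z. hf z - trig_poly (riesz_coeffs c) z) \<le> K * \<delta>"
      using R(1) c K unfolding riesz_rel_def by (meson less_imp_le mult_left_mono order_trans)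
    have G: "Lp_norm p (\<lambda>z. hg z - trig_poly (riesz_coeffs d) z) \<le> K * \<delta>"
      using R(2) d K unfolding riesz_rel_def by (meson less_imp_le mult_left_mono order_trans)
    have "(\<lambda>z. ?h z - trig_poly (riesz_coeffs ?b) z)
        = (\<lambda>z. a * (hf z - trig_poly (riesz_coeffs c) z) + (hg z - trig_poly (riesz_coeffs d) z))"
      by (intro ext) (simp only: rb, simp add: algebra_simps)
    then have 2: "Lp_norm p (\<lambda>z. ?h z - trig_poly (riesz_coeffs ?b) z) \<le> cmod a * (K * \<delta>) + K * \<delta>"
      by (simp only:) (intro order_trans[OF tri] add_mono mult_left_mono F G Lp_intros norm_ge_zero)
    have "Lp_norm p (\<lambda>z. hl z - ?h z)
        \<le> Lp_norm p (\<lambda>z. hl z - trig_poly (riesz_coeffs ?b) z) + Lp_norm p (\<lambda>z. trig_poly (riesz_coeffs ?b) z - ?h z)"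
      by (rule Lp_norm_triangle_diff) (intro Lp_intros)+
    also have "\<dots> \<le> K * (cmod a * \<delta> + \<delta>) + (cmod a * (K * \<delta>) + K * \<delta>)"
      using 1 2 by (simp add: Lp_norm_minus_commute[of p "trig_poly (riesz_coeffs ?b)"])
    also have "\<dots> = (2 * K * (cmod a + 1)) * \<delta>" by (simp add: algebra_simps)
    also have "\<dots> \<le> (2 * K * (cmod a + 1) + 1) * \<delta>" using \<delta> by (intro mult_right_mono) auto
    also have "\<dots> = e" using den by (simp add: \<delta>_def)
    finally show ?thesis .
  qed
  then have le0: "Lp_norm p (\<lambda>z. hl z - ?h z) \<le> 0"
    using field_le_epsilon[of "Lp_norm p (\<lambda>z. hl z - ?h z)" 0] by simp
  have "AE z in circle. hl z - ?h z = 0"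
    by (rule Lp_norm_eq_0_imp_AE[OF _ p0 le0]) (intro Lp_intros)
  then show ?thesis by eventually_elim simp
qed

theorem mainTheorem1:
  fixes p q :: real
  assumes "1 < p" and "1 / p + 1 / q = 1"
  shows "\<exists>P. bounded_linear_Lp p P \<and> extends_riesz_projection P \<and>
             (\<forall>f\<in>Lp p. Lp_norm p (P f) \<le> max p q * Lp_norm p f)"
proof -
  define K where "K = max p q"
  have p: "1 < p" "1 \<le> p" "0 < p" using assms by auto
  have K: "0 \<le> K" using p by (simp add: K_def)
  have norm_le: "Lp_norm p (trig_poly (riesz_coeffs c)) \<le> K * Lp_norm p (trig_poly c)"
    if "finite {n. c n \<noteq> 0}" for c
    unfolding K_def by (rule riesz_norm_le[OF that assms])
  \<comment> \<open>A choice of representative for each function separately, so congruence and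
    linearity can hold only almost everywhere; both come from
    \<open>riesz_rel_linear\<close>.\<close>
  define P where "P f = (SOME h. riesz_rel K p f h)" for f
  have R: "riesz_rel K p f (P f)" if "f \<in> Lp p" for f
    unfolding P_def using riesz_rel_total[OF p(1) K norm_le that] by (rule someI_ex)
  \<comment> \<open>The value of P at 0 is itself an arbitrary choice. The exact pair (0, 0) lets
    \<open>riesz_rel_linear\<close> drop its second summand, for congruence and for
    homogeneity.\<close>
  have zero: "(\<lambda>z. 0) \<in> Lp p" "riesz_rel K p (\<lambda>z. 0) (\<lambda>z. 0)"
  proof -
    show 0: "(\<lambda>z. 0) \<in> Lp p" using p by (simp add: Lp_continuous)
    have "Lp_norm p (\<lambda>z. - u z) = Lp_norm p u" for u by (simp add: Lp_norm_def)
    then show "riesz_rel K p (\<lambda>z. 0) (\<lambda>z. 0)"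
      using 0 norm_le by (simp add: riesz_rel_def)
  qed
  have P: "P f \<in> Lp p" if "f \<in> Lp p" for f using R[OF that] by (simp add: riesz_rel_def)
  have bound: "Lp_norm p (P f) \<le> K * Lp_norm p f" if "f \<in> Lp p" for f
  proof -
    have "trig_poly (riesz_coeffs (\<lambda>_. 0)) = (\<lambda>z. 0)" "trig_poly (\<lambda>_. 0) = (\<lambda>z. 0)"
      by (auto simp: trig_poly_def riesz_coeffs_def)
    with R[OF that] show ?thesis
      unfolding riesz_rel_def by (auto dest!: spec[where x = "\<lambda>_. 0"])
  qed
  have cong: "AE z in circle. P f z = P g z"
    if "f \<in> Lp p" "g \<in> Lp p" "AE z in circle. f z = g z" for f g
    using riesz_rel_linear[OF p(1) K that(2) zero(1) that(1) R[OF that(2)] zero(2) R[OF that(1)], of 1]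
      that(3) by simp
  have add: "AE z in circle. P (\<lambda>w. f w + g w) z = P f z + P g z"
    if "f \<in> Lp p" "g \<in> Lp p" for f g
    using riesz_rel_linear[OF p(1) K that Lp_add[OF that p(2)] R R R, of 1] that Lp_add[OF that p(2)] by simp
  have cmult: "AE z in circle. P (\<lambda>w. a * f w) z = a * P f z" if "f \<in> Lp p" for a f
    using riesz_rel_linear[OF p(1) K that zero(1) Lp_cmult[OF that] R zero(2) R, of a a]
      that Lp_cmult[OF that] by simp
  have ext: "AE z in circle. P (trig_poly c) z = trig_poly (riesz_coeffs c) z"
    if c: "finite {n. c n \<noteq> 0}" for c
  proof -
    have t: "trig_poly d \<in> Lp p" for d using p by (intro trig_poly_in_Lp)
    \<comment> \<open>The polynomial c is compared with itself, so the right-hand side of the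
      defining estimate is K times the norm of 0.\<close>
    have "Lp_norm p (\<lambda>z. P (trig_poly c) z - trig_poly (riesz_coeffs c) z) \<le> 0"
      using R[OF t, of c] c by (auto simp: riesz_rel_def Lp_norm_def dest!: spec[where x = c])
    then have "AE z in circle. P (trig_poly c) z - trig_poly (riesz_coeffs c) z = 0"
      by (intro Lp_norm_eq_0_imp_AE[of _ p] Lp_diff P t p)
    then show ?thesis by eventually_elim simp
  qed
  have "bounded_linear_Lp p P"
    unfolding bounded_linear_Lp_def using P cong add cmult bound by blast
  moreover have "extends_riesz_projection P"
    unfolding extends_riesz_projection_def using ext by blast
  ultimately show ?thesis using bound unfolding K_def by blast
qed

end
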